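(* Let $G=GL_n(\mathbb{C})$, $\mathfrak{g}=\mathfrak{gl}_n(\mathbb{C})$, and let $O_1,O_2\subset\mathfrak{g}^*\cong\mathfrak{g}$ be semisimple (co)adjoint orbits, each equipped with a Poisson bracket of the form $\overleftarrow{r}+\overrightarrow{s}$ with $s=s^0+a\kappa$ for some $a\in\mathbb{C}$ (the constant $a$ may be different for the two orbits; see the context). A $G$-equivariant map $P\colon O_1\to O_2$ is Poisson if and only if the following three conditions are satisfied: (a) the orbit $O_2$ is symmetric, i.e. its matrices have exactly two different eigenvalues; (b) there exist $\lambda\in O_1$ and $\mu\in O_2$ (diagonal matrices $\lambda=\mathrm{diag}(\Lambda_1,\ldots,\Lambda_l)$ and $\mu=\mathrm{diag}(\mathrm{M}_1,\mathrm{M}_2)$, where $\Lambda_i$, resp. $\mathrm{M}_j$, are scalar blocks corresponding to the pairwise distinct eigenvalues $\lambda_i$ of $\lambda$, resp. $\mu_j$ of $\mu$) such that $P(\lambda)=\mu$ and the multiplicity $n_1$ of the eigenvalue $\lambda_1$ is equal to the multiplicity $m_1$ of the eigenvalue $\mu_1$; (c) the Poisson structures on $O_1$ and $O_2$ are defined by $s_\lambda=s^0_\lambda-2\lambda_1\kappa_\lambda$ and $s_\mu=s^0_\mu-2\mu_1\kappa_\mu$ respectively, with $\lambda,\mu$ as in (b).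
   Context: The trace form identifies $\mathfrak{g}^*$ with $\mathfrak{g}$ and coadjoint orbits with adjoint orbits. $G$ acts on matrices on the right by $X\cdot g=g^{-1}Xg$. A semisimple orbit $O$ contains diagonal matrices $\lambda=\mathrm{diag}(\Lambda_1,\ldots,\Lambda_l)$, with $\Lambda_i$ the scalar $n_i\times n_i$ block with eigenvalue $\lambda_i$ and $\lambda_1,\dots,\lambda_l$ pairwise distinct (the eigenvalues may be listed in any order); then $O=O_\lambda\cong G^\lambda\backslash G$, where $G^\lambda$ is the stabilizer of $\lambda$, with Lie algebra $\mathfrak{g}^\lambda$. Let $E_{st}$ be the matrix units and $I_i=\{n_1+\dots+n_{i-1}+1,\dots,n_1+\dots+n_i\}$. For $i\neq j$ put $\xi_{ij}=\sum_{s\in I_i,\,t\in I_j}E_{st}\wedge E_{ts}$ modulo $\mathfrak{g}\wedge\mathfrak{g}^\lambda$, an element of $(\wedge^2(\mathfrak{g}/\mathfrak{g}^\lambda))^{\mathfrak{g}^\lambda}$. Put $$\kappa_\lambda=\sum_{1\le i<j\le l}\frac{1}{\lambda_i-\lambda_j}\,\xi_{ij},\qquad s^0_\lambda=\sum_{1\le i<j\le l}\frac{\lambda_i+\lambda_j}{\lambda_i-\lambda_j}\,\xi_{ij}.$$ For $s\in(\wedge^2(\mathfrak{g}/\mathfrak{g}^\lambda))^{\mathfrak{g}^\lambda}$, $\overrightarrow{s}$ denotes the $G$-invariant bivector field on $O_\lambda\cong G^\lambda\backslash G$ generated by $s$ (its value at the base point $\lambda$ is $s$, under $T_\lambda O_\lambda\cong\mathfrak{g}/\mathfrak{g}^\lambda$).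 $\mathfrak{g}$ carries a factorizable Lie bialgebra structure with classical r-matrix $r\in\wedge^2\mathfrak{g}$ (satisfying the modified classical Yang–Baxter equation), and $\overleftarrow{r}$ is the bivector field on $O_\lambda$ generated by $r$ via the action of $G$. The r-matrix is normalized so that $[\overleftarrow{r},\overleftarrow{r}]=-[\overrightarrow{s^0_\lambda},\overrightarrow{s^0_\lambda}]$ (Schouten brackets). Then for every $a\in\mathbb{C}$ the bivector $\overleftarrow{r}+\overrightarrow{s}$ with $s=s_\lambda=s^0_\lambda+a\kappa_\lambda$ is a Poisson bracket on $O_\lambda$; these are the brackets restricted from $\mathfrak{g}^*$. The Poisson structure is said to be defined by $s_\lambda$.
   Formalization: The "only if" direction is proved only when P is not injective and O_2 is not a single point; without this it is false (identity map of an orbit with three eigenvalues, or a map to a point, is Poisson but violates (a)). The "if" direction is unrestricted. *)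

theory Defs
  imports "HOL-Analysis.Analysis"
begin

section \<open>Matrices, orbits and block-diagonal base points\<close>

type_synonym 'n cmat = "complex ^ 'n ^ 'n"

definition mscale :: "complex \<Rightarrow> 'n::finite cmat \<Rightarrow> 'n cmat" where
  "mscale c A = (\<chi> i j. c * A $ i $ j)"

definition munit :: "'n::finite \<times> 'n \<Rightarrow> 'n cmat" where
  "munit a = (\<chi> i j. if (i, j) = a then 1 else 0)"

definition lie :: "'n::finite cmat \<Rightarrow> 'n cmat \<Rightarrow> 'n cmat" where
  "lie A B = A ** B - B ** A"

definition conj_act :: "'n::finite cmat \<Rightarrow> 'n cmat \<Rightarrow> 'n cmat" where
  "conj_act X g = matrix_inv g ** X ** g"

definition adj_orbit :: "'n::finite cmat \<Rightarrow> 'n cmat set" where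
  "adj_orbit X = {conj_act X g | g. invertible g}"

definition semisimple :: "'n::finite cmat \<Rightarrow> bool" where
  "semisimple X \<longleftrightarrow>
     (\<exists>g. invertible g \<and> (\<forall>i j. i \<noteq> j \<longrightarrow> conj_act X g $ i $ j = 0))"

definition semisimple_orbit :: "'n::finite cmat set \<Rightarrow> bool" where
  "semisimple_orbit Orb \<longleftrightarrow> (\<exists>X. semisimple X \<and> Orb = adj_orbit X)"

definition eigenvalues :: "'n::finite cmat \<Rightarrow> complex set" where
  "eigenvalues X = {c. \<exists>v. v \<noteq> 0 \<and> X *v v = c *s v}"

definition symmetric_orbit :: "'n::finite cmat set \<Rightarrow> bool" where
  "symmetric_orbit Orb \<longleftrightarrow>
     semisimple_orbit Orb \<and> (\<forall>X\<in>Orb. card (eigenvalues X) = 2)"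

text \<open>
  The list of pairs (eigenvalue, multiplicity) encodes the matrix
  diag of scalar blocks. List positions and ranks of indices are counted from 0, so
  the pair with number 0 is the first block.
\<close>

definition valid_blocks :: "'n::finite itself \<Rightarrow> (complex \<times> nat) list \<Rightarrow> bool" where
  "valid_blocks _ bs \<longleftrightarrow>
     distinct (map fst bs) \<and> (\<forall>b\<in>set bs. 0 < snd b) \<and> sum_list (map snd bs) = CARD('n)"

definition rank_of :: "'n::{finite,linorder} \<Rightarrow> nat" where
  "rank_of i = card {j. j < i}"

definition block_diag :: "(complex \<times> nat) list \<Rightarrow> 'n::{finite,linorder} cmat" where
  "block_diag bs =
     (\<chi> i j. if i = j then concat (map (\<lambda>(c, m). replicate m c) bs) ! rank_of i else 0)"

definition block_indices :: "(complex \<times> nat) list \<Rightarrow> nat \<Rightarrow> 'n::{finite,linorder} set" where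
  "block_indices bs p =
     {k. sum_list (map snd (take p bs)) \<le> rank_of k \<and>
         rank_of k < sum_list (map snd (take (Suc p) bs))}"

definition block_base ::
    "'n::{finite,linorder} cmat set \<Rightarrow> (complex \<times> nat) list \<Rightarrow> bool" where
  "block_base Orb bs \<longleftrightarrow> valid_blocks TYPE('n) bs \<and> block_diag bs \<in> Orb"

section \<open>Tensors and r-matrices\<close>

text \<open>
  A tensor in the second (third) tensor power of \<open>gl\<^sub>n\<close> is given by its coefficients with
  respect to the basis of matrix units \<open>munit a\<close>.
\<close>

type_synonym 'n tens2 = "'n \<times> 'n \<Rightarrow> 'n \<times> 'n \<Rightarrow> complex"
type_synonym 'n tens3 = "'n \<times> 'n \<Rightarrow> 'n \<times> 'n \<Rightarrow> 'n \<times> 'n \<Rightarrow> complex"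

definition wedge :: "'n::finite cmat \<Rightarrow> 'n cmat \<Rightarrow> 'n tens2" where
  "wedge A B = (\<lambda>(i, j) (k, l). A $ i $ j * B $ k $ l - B $ i $ j * A $ k $ l)"

definition struct_const :: "'n::finite \<times> 'n \<Rightarrow> 'n \<times> 'n \<Rightarrow> 'n \<times> 'n \<Rightarrow> complex" where
  "struct_const a b c = lie (munit a) (munit b) $ fst c $ snd c"

text \<open>\<open>cyb T\<close> is \<open>[T\<^sub>1\<^sub>2, T\<^sub>1\<^sub>3] + [T\<^sub>1\<^sub>2, T\<^sub>2\<^sub>3] + [T\<^sub>1\<^sub>3, T\<^sub>2\<^sub>3]\<close>.\<close>

definition cyb :: "'n::finite tens2 \<Rightarrow> 'n tens3" where
  "cyb T = (\<lambda>x y z. \<Sum>a\<in>UNIV. \<Sum>b\<in>UNIV.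
       struct_const a b x * T a y * T b z
     + struct_const a b y * T x a * T b z
     + struct_const a b z * T x a * T y b)"

definition ad_invariant2 :: "'n::finite tens2 \<Rightarrow> bool" where
  "ad_invariant2 T \<longleftrightarrow> (\<forall>c x y.
     (\<Sum>a\<in>UNIV. struct_const c a x * T a y + struct_const c a y * T x a) = 0)"

definition ad_invariant3 :: "'n::finite tens3 \<Rightarrow> bool" where
  "ad_invariant3 T \<longleftrightarrow> (\<forall>c x y z.
     (\<Sum>a\<in>UNIV. struct_const c a x * T a y z + struct_const c a y * T x a z
        + struct_const c a z * T x y a) = 0)"

definition skew :: "'n::finite tens2 \<Rightarrow> bool" where
  "skew T \<longleftrightarrow> (\<forall>a b. T a b = - T b a)"

definition mcybe :: "'n::finite tens2 \<Rightarrow> bool" where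
  "mcybe r \<longleftrightarrow> ad_invariant3 (cyb r)"

definition nondegenerate :: "'n::finite tens2 \<Rightarrow> bool" where
  "nondegenerate T \<longleftrightarrow>
     (\<forall>v. (\<forall>b. (\<Sum>a\<in>UNIV. v a * T a b) = 0) \<longrightarrow> (\<forall>a. v a = 0))"

text \<open>
  The Lie bialgebra with cobracket the coboundary of the skew tensor \<open>r\<close> is factorizable if \<open>r\<close>
  is the skew part of a solution of the classical Yang-Baxter equation whose symmetric part
  is invariant and nondegenerate.
\<close>

definition factorizable :: "'n::finite tens2 \<Rightarrow> bool" where
  "factorizable r \<longleftrightarrow> (\<exists>t.
     (\<forall>a b. t a b = t b a) \<and> ad_invariant2 t \<and> nondegenerate t \<and>
     (\<forall>x y z. cyb (\<lambda>a b. r a b + t a b) x y z = 0))"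

definition r_matrix :: "'n::finite tens2 \<Rightarrow> bool" where
  "r_matrix r \<longleftrightarrow> skew r \<and> mcybe r \<and> factorizable r"

text \<open>
  Elements of the second exterior power of \<open>g / g\<^sup>\<lambda>\<close> are given by representatives in the
  second exterior power of \<open>g\<close>. The fundamental vector fields of \<open>g\<^sup>\<lambda>\<close> vanish at the
  point \<open>\<lambda>\<close>, so the bivector \<open>bivector_at s \<lambda>\<close> below depends only on the class.
\<close>

definition xi :: "(complex \<times> nat) list \<Rightarrow> nat \<Rightarrow> nat \<Rightarrow> 'n::{finite,linorder} tens2" where
  "xi bs p q = (\<lambda>a b. \<Sum>s\<in>block_indices bs p. \<Sum>t\<in>block_indices bs q.
     wedge (munit (s, t)) (munit (t, s)) a b)"

definition kappa :: "(complex \<times> nat) list \<Rightarrow> 'n::{finite,linorder} tens2" where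
  "kappa bs = (\<lambda>a b. \<Sum>q<length bs. \<Sum>p<q.
     1 / (fst (bs ! p) - fst (bs ! q)) * xi bs p q a b)"

definition s0 :: "(complex \<times> nat) list \<Rightarrow> 'n::{finite,linorder} tens2" where
  "s0 bs = (\<lambda>a b. \<Sum>q<length bs. \<Sum>p<q.
     (fst (bs ! p) + fst (bs ! q)) / (fst (bs ! p) - fst (bs ! q)) * xi bs p q a b)"

definition s_tensor ::
    "(complex \<times> nat) list \<Rightarrow> complex \<Rightarrow> 'n::{finite,linorder} tens2" where
  "s_tensor bs c = (\<lambda>a b. s0 bs a b + c * kappa bs a b)"

section \<open>Bivector fields on orbits\<close>

text \<open>
  Holomorphic functions on an orbit as a complex submanifold of the space of matrices:
  locally restrictions of holomorphic functions of the matrix entries.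
  Values outside the orbit are irrelevant.
\<close>

definition holo :: "'n::finite cmat set \<Rightarrow> ('n cmat \<Rightarrow> complex) set" where
  "holo Orb = {f. \<forall>X\<in>Orb. \<exists>U F. open U \<and> X \<in> U \<and>
     (\<forall>Y\<in>U. \<exists>F'. (F has_derivative F') (at Y) \<and> (\<forall>c V. F' (mscale c V) = c * F' V)) \<and>
     (\<forall>Y\<in>U \<inter> Orb. f Y = F Y)}"

text \<open>
  The derivative of \<open>f\<close> at \<open>X\<close> along the fundamental vector field of \<open>A\<close>. The curve
  \<open>t \<mapsto> 1 + t A\<close> has the same tangent vector at \<open>0\<close> as the exponential of \<open>t A\<close>, so this is the
  differential of \<open>f\<close> on the tangent vector \<open>[X, A]\<close>. It only uses values of \<open>f\<close> on the
  orbit of \<open>X\<close>.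
\<close>

definition fund_deriv ::
    "'n::finite cmat \<Rightarrow> ('n cmat \<Rightarrow> complex) \<Rightarrow> 'n cmat \<Rightarrow> complex" where
  "fund_deriv A f X = deriv (\<lambda>t. f (conj_act X (mat 1 + mscale t A))) 0"

text \<open>
  The pairing of \<open>df \<and> dh\<close> with the bivector at \<open>X\<close> that is the image of the tensor \<open>T\<close> under
  \<open>A \<mapsto> [X, A]\<close>, the isomorphism of \<open>g / g\<^sup>X\<close> with the tangent space of the orbit.
\<close>

definition bivector_at ::
    "'n::finite tens2 \<Rightarrow> 'n cmat \<Rightarrow> ('n cmat \<Rightarrow> complex) \<Rightarrow> ('n cmat \<Rightarrow> complex) \<Rightarrow> complex" where
  "bivector_at T X f h =
     (\<Sum>a\<in>UNIV. \<Sum>b\<in>UNIV. T a b * fund_deriv (munit a) f X * fund_deriv (munit b) h X)"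

text \<open>Bivector fields are given as the corresponding brackets \<open>{f, h}\<close> of functions.\<close>

type_synonym 'n bifield =
  "('n cmat \<Rightarrow> complex) \<Rightarrow> ('n cmat \<Rightarrow> complex) \<Rightarrow> 'n cmat \<Rightarrow> complex"

definition bifield_eq :: "'n::finite cmat set \<Rightarrow> 'n bifield \<Rightarrow> 'n bifield \<Rightarrow> bool" where
  "bifield_eq Orb \<pi> \<rho> \<longleftrightarrow> (\<forall>f\<in>holo Orb. \<forall>h\<in>holo Orb. \<forall>X\<in>Orb. \<pi> f h X = \<rho> f h X)"

definition action_field :: "'n::finite tens2 \<Rightarrow> 'n bifield" where
  "action_field r f h X = bivector_at r X f h"

text \<open>
  The invariant bivector field with value \<open>s\<close> at the base point \<open>L\<close>: its value at
  \<open>X = L \<cdot> g\<close> is the push-forward of \<open>s\<close> under \<open>Y \<mapsto> Y \<cdot> g\<close>. If \<open>s\<close> is invariant under the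
  stabilizer of \<open>L\<close> modulo the wedge product of \<open>g\<close> with \<open>g\<^sup>L\<close>, the choice of \<open>g\<close> does not matter.
\<close>

definition invariant_field :: "'n::finite cmat \<Rightarrow> 'n tens2 \<Rightarrow> 'n bifield" where
  "invariant_field L s f h X =
     (let g = SOME g. invertible g \<and> X = conj_act L g
      in bivector_at s L (\<lambda>Y. f (conj_act Y g)) (\<lambda>Y. h (conj_act Y g)))"

definition rs_field ::
    "'n::{finite,linorder} tens2 \<Rightarrow> (complex \<times> nat) list \<Rightarrow> complex \<Rightarrow> 'n bifield" where
  "rs_field r bs c = (\<lambda>f h X.
     action_field r f h X + invariant_field (block_diag bs) (s_tensor bs c) f h X)"

text \<open>
  The Schouten bracket of two skew biderivations as a triderivation: the sum over the
  (2,1)-shuffles, evaluated on functions.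
\<close>

definition schouten :: "'n::finite bifield \<Rightarrow> 'n bifield \<Rightarrow>
    ('n cmat \<Rightarrow> complex) \<Rightarrow> ('n cmat \<Rightarrow> complex) \<Rightarrow> ('n cmat \<Rightarrow> complex) \<Rightarrow> 'n cmat \<Rightarrow> complex" where
  "schouten \<pi> \<rho> f g h X =
     \<pi> (\<rho> f g) h X - \<pi> (\<rho> f h) g X + \<pi> (\<rho> g h) f X
   + \<rho> (\<pi> f g) h X - \<rho> (\<pi> f h) g X + \<rho> (\<pi> g h) f X"

definition normalized_on :: "'n::{finite,linorder} cmat set \<Rightarrow> 'n tens2 \<Rightarrow> bool" where
  "normalized_on Orb r \<longleftrightarrow> (\<forall>bs. block_base Orb bs \<longrightarrow>
     (\<forall>f\<in>holo Orb. \<forall>g\<in>holo Orb. \<forall>h\<in>holo Orb. \<forall>X\<in>Orb.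
        schouten (action_field r) (action_field r) f g h X =
        - schouten (invariant_field (block_diag bs) (s0 bs))
                   (invariant_field (block_diag bs) (s0 bs)) f g h X))"

text \<open>The structure \<open>\<pi>\<close> on the orbit is defined by \<open>s\<^sup>0\<^sub>\<lambda> + c \<kappa>\<^sub>\<lambda>\<close>, where \<open>\<lambda> = block_diag bs\<close>.\<close>

definition defined_by :: "'n::{finite,linorder} cmat set \<Rightarrow> 'n tens2 \<Rightarrow>
    (complex \<times> nat) list \<Rightarrow> complex \<Rightarrow> 'n bifield \<Rightarrow> bool" where
  "defined_by Orb r bs c \<pi> \<longleftrightarrow> block_base Orb bs \<and> bifield_eq Orb \<pi> (rs_field r bs c)"

section \<open>Equivariant and Poisson maps\<close>

definition equivariant_map ::
    "'n::finite cmat set \<Rightarrow> 'n cmat set \<Rightarrow> ('n cmat \<Rightarrow> 'n cmat) \<Rightarrow> bool" where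
  "equivariant_map Orb1 Orb2 P \<longleftrightarrow> P ` Orb1 \<subseteq> Orb2 \<and>
     (\<forall>X\<in>Orb1. \<forall>g. invertible g \<longrightarrow> P (conj_act X g) = conj_act (P X) g)"

definition poisson_map :: "'n::finite cmat set \<Rightarrow> 'n bifield \<Rightarrow> 'n cmat set \<Rightarrow> 'n bifield \<Rightarrow>
    ('n cmat \<Rightarrow> 'n cmat) \<Rightarrow> bool" where
  "poisson_map Orb1 \<pi>1 Orb2 \<pi>2 P \<longleftrightarrow>
     P ` Orb1 \<subseteq> Orb2 \<and> (\<forall>f\<in>holo Orb2. f \<circ> P \<in> holo Orb1) \<and>
     (\<forall>f\<in>holo Orb2. \<forall>h\<in>holo Orb2. \<forall>X\<in>Orb1. \<pi>1 (f \<circ> P) (h \<circ> P) X = \<pi>2 f h (P X))"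

end

(* Write [df, dh] for the commutator of gradients with respect to the trace form. At a diagonal
   base point the coefficients (l_i + l_j + c) / (l_i - l_j) of the invariant bivector turn, after
   pairing with two differentials, into those of tr((X^2 + c X) [df, dh]); this expression only
   involves X, so the field does not depend on the choice and ordering of the base point. The part
   generated by r is compatible with every equivariant map. As P(diag d) commutes with the
   stabilizer of diag d, it is diag e with e a function of d, and comparing the invariant parts
   shows that P is Poisson iff
     (d_s + d_t + a) / (d_s - d_t) = (e_s + e_t + b) / (e_s - e_t)   whenever e_s differs from e_t.
   If P identifies two eigenvalues d_i, d_j and e_k differs from their image, the equations for (i, k)
   and (j, k) have equal right-hand sides, which forces a = -2 d_k. Hence all such k belong to one
   block; both sides then equal 1 for (i, k), and b = -2 e_k. *)
theory Submission
  imports Defs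
begin

section \<open>Matrices and conjugation\<close>

lemma munit_nth [simp]: "munit a $ i $ j = (if (i, j) = a then 1 else 0)"
  by (simp add: munit_def)

lemma mscale_nth [simp]: "mscale c A $ i $ j = c * A $ i $ j"
  by (simp add: mscale_def)

lemma matrix_matrix_mult_nth: "(A ** B) $ i $ j = (\<Sum>k\<in>UNIV. A $ i $ k * B $ k $ j)"
  by (simp add: matrix_matrix_mult_def)

lemma mscale_zero [simp]: "mscale 0 A = 0"
  by (simp add: vec_eq_iff)

lemma mscale_mult_left: "mscale c A ** B = mscale c (A ** B)"
  by (simp add: vec_eq_iff matrix_matrix_mult_nth sum_distrib_left mult.assoc)

lemma mscale_mult_right: "A ** mscale c B = mscale c (A ** B)"
  by (simp add: vec_eq_iff matrix_matrix_mult_nth sum_distrib_left algebra_simps)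

lemma mscale_add: "mscale c (A + B) = mscale c A + mscale c B"
  by (simp add: vec_eq_iff algebra_simps)

lemma mscale_diff: "mscale c (A - B) = mscale c A - mscale c B"
  by (simp add: vec_eq_iff algebra_simps)

lemma matrix_diff_ldistrib: "(A :: 'n::finite cmat) ** (B - C) = A ** B - A ** C"
  by (simp add: vec_eq_iff matrix_matrix_mult_nth sum_subtractf algebra_simps)

lemma matrix_diff_rdistrib: "(A - B) ** (C :: 'n::finite cmat) = A ** C - B ** C"
  by (simp add: vec_eq_iff matrix_matrix_mult_nth sum_subtractf algebra_simps)

lemma matrix_add_rdistrib: "(A + B) ** (C :: 'n::finite cmat) = A ** C + B ** C"
  by (simp add: vec_eq_iff matrix_matrix_mult_nth sum.distrib algebra_simps)

section \<open>Conjugation as a right action, and its orbits\<close>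

lemma matrix_inv_inverse:
  assumes "invertible (g :: 'n::finite cmat)"
  shows "g ** matrix_inv g = mat 1" "matrix_inv g ** g = mat 1"
  using assms unfolding invertible_def matrix_inv_def by (metis (mono_tags, lifting) someI_ex)+

lemma invertible_matrix_inv:
  assumes "invertible (g :: 'n::finite cmat)"
  shows "invertible (matrix_inv g)"
  using matrix_inv_inverse[OF assms] unfolding invertible_def by blast

text \<open>Together with \<open>mult_conj_act\<close> this trades conjugation for the intertwining
  relation \<open>X ** g = g ** Y\<close>, so later computations rarely have to handle the
  inverse.\<close>

lemma conj_act_eqI:
  assumes "invertible g" "X ** g = g ** Y"
  shows "conj_act X g = Y"
proof -
  have "conj_act X g = matrix_inv g ** (X ** g)"
    by (simp only: conj_act_def matrix_mul_assoc)
  also have "\<dots> = (matrix_inv g ** g) ** Y"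
    by (simp only: assms(2) matrix_mul_assoc)
  finally show ?thesis
    by (simp add: matrix_inv_inverse[OF assms(1)])
qed

lemma mult_conj_act:
  assumes "invertible g"
  shows "g ** conj_act X g = X ** g"
proof -
  have "g ** conj_act X g = (g ** matrix_inv g) ** X ** g"
    by (simp only: conj_act_def matrix_mul_assoc)
  then show ?thesis
    by (simp add: matrix_inv_inverse[OF assms])
qed

lemma conj_act_conj_act:
  assumes "invertible g" "invertible h"
  shows "conj_act (conj_act X g) h = conj_act X (g ** h)"
proof -
  have "(g ** h) ** conj_act (conj_act X g) h = g ** conj_act X g ** h"
    by (simp only: matrix_mul_assoc[symmetric] mult_conj_act[OF assms(2)])
  also have "\<dots> = X ** (g ** h)"
    by (simp only: mult_conj_act[OF assms(1)] matrix_mul_assoc)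
  finally show ?thesis
    using conj_act_eqI[OF invertible_mult[OF assms]] by metis
qed

lemma invertible_one: "invertible (mat 1 :: 'n::finite cmat)"
  by (simp add: invertible_det_nz)

lemma conj_act_one [simp]: "conj_act X (mat 1) = X"
  by (rule conj_act_eqI[OF invertible_one]) simp

lemma conj_act_mult:
  assumes "invertible g"
  shows "conj_act (X ** Y) g = conj_act X g ** conj_act Y g"
proof (rule conj_act_eqI[OF assms])
  have "g ** (conj_act X g ** conj_act Y g) = X ** g ** conj_act Y g"
    by (simp only: matrix_mul_assoc mult_conj_act[OF assms])
  also have "\<dots> = X ** Y ** g"
    by (simp only: matrix_mul_assoc[symmetric] mult_conj_act[OF assms])
  finally show "X ** Y ** g = g ** (conj_act X g ** conj_act Y g)" ..
qed

lemma conj_act_add: "conj_act (X + Y) g = conj_act X g + conj_act Y g"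
  by (simp add: conj_act_def matrix_add_ldistrib matrix_add_rdistrib)

lemma conj_act_diff: "conj_act (X - Y) g = conj_act X g - conj_act Y g"
  by (simp add: conj_act_def matrix_diff_ldistrib matrix_diff_rdistrib)

lemma conj_act_mscale: "conj_act (mscale c X) g = mscale c (conj_act X g)"
  by (simp add: conj_act_def mscale_mult_left mscale_mult_right)

lemma conj_act_mat_one:
  assumes "invertible g"
  shows "conj_act (mat 1) g = mat 1"
  by (rule conj_act_eqI[OF assms]) (simp add: matrix_mul_lid matrix_mul_rid)

lemma conj_act_lie:
  assumes "invertible g"
  shows "conj_act (lie X Y) g = lie (conj_act X g) (conj_act Y g)"
  by (simp add: lie_def conj_act_diff conj_act_mult assms)

lemma adj_orbitI: "invertible g \<Longrightarrow> conj_act X g \<in> adj_orbit X"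
  by (auto simp: adj_orbit_def)

lemma self_mem_adj_orbit: "X \<in> adj_orbit X"
  by (metis adj_orbitI conj_act_one invertible_one)

lemma conj_act_inverse:
  assumes "invertible g"
  shows "conj_act (conj_act X g) (matrix_inv g) = X"
  by (simp add: assms conj_act_conj_act invertible_matrix_inv matrix_inv_inverse)

lemma adj_orbit_eq:
  assumes "Y \<in> adj_orbit X"
  shows "adj_orbit Y = adj_orbit X"
proof -
  obtain g where g: "invertible g" "Y = conj_act X g"
    using assms by (auto simp: adj_orbit_def)
  have X: "conj_act Y (matrix_inv g) = X"
    by (simp add: g conj_act_inverse)
  have trans: "adj_orbit (conj_act W h) \<subseteq> adj_orbit W" if "invertible h" for W h :: "'a cmat"
  proof
    fix V assume "V \<in> adj_orbit (conj_act W h)"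
    then obtain k where "invertible k" "V = conj_act (conj_act W h) k"
      by (auto simp: adj_orbit_def)
    then show "V \<in> adj_orbit W"
      by (simp add: that conj_act_conj_act adj_orbitI invertible_mult)
  qed
  show ?thesis
    using trans[OF g(1), of X] trans[OF invertible_matrix_inv[OF g(1)], of Y]
    unfolding X g(2)[symmetric] by (rule equalityI)
qed

section \<open>Differentiation along fundamental vector fields\<close>

lemma bounded_bilinear_matrix_mult:
  "bounded_bilinear ((**) :: 'n::finite cmat \<Rightarrow> 'n cmat \<Rightarrow> 'n cmat)"
  unfolding bilinear_conv_bounded_bilinear[symmetric] bilinear_def
  by (intro conjI allI linearI)
     (simp_all add: matrix_add_ldistrib matrix_add_rdistrib vec_eq_iff matrix_matrix_mult_nth
        scaleR_sum_right)

lemma bounded_bilinear_mscale: "bounded_bilinear (mscale :: complex \<Rightarrow> 'n::finite cmat \<Rightarrow> 'n cmat)"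
  unfolding bilinear_conv_bounded_bilinear[symmetric] bilinear_def
  by (intro conjI allI linearI) (simp_all add: vec_eq_iff algebra_simps)

text \<open>The determinant is continuous in \<open>t\<close> with value 1 at 0. Hence the curve
  used in \<open>fund_deriv\<close> stays on the orbit near 0, which is all that derivatives there
  see.\<close>

lemma eventually_invertible_one_plus:
  "eventually (\<lambda>t. invertible (mat 1 + mscale t A)) (nhds (0::complex))"
proof -
  have "continuous_on UNIV (\<lambda>t. det (mat 1 + mscale t A))"
    unfolding det_def by (simp, intro continuous_intros)
  then have "isCont (\<lambda>t. det (mat 1 + mscale t A)) 0"
    by (simp add: continuous_on_eq_continuous_at)
  then have "((\<lambda>t. det (mat 1 + mscale t A)) \<longlongrightarrow> det (mat 1 + mscale 0 A)) (nhds 0)"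
    unfolding isCont_def using tendsto_at_iff_tendsto_nhds by blast
  then have "eventually (\<lambda>t. det (mat 1 + mscale t A) \<noteq> 0) (nhds 0)"
    by (rule tendsto_imp_eventually_ne) simp
  then show ?thesis
    by (simp add: invertible_det_nz)
qed

text \<open>Exact and not only to first order: \<open>X ** (1 + t A)\<close> differs from
  \<open>(1 + t A) ** X\<close> by \<open>t [X, A]\<close>, so the increment of the curve carries an
  explicit factor \<open>t\<close>.\<close>

lemma conj_act_one_plus:
  assumes "invertible (mat 1 + mscale t A)"
  shows "conj_act X (mat 1 + mscale t A) =
    X + mscale t (matrix_inv (mat 1 + mscale t A) ** lie X A)"
    (is "conj_act X ?h = ?Y")
proof (rule conj_act_eqI[OF assms])
  have "?h ** ?Y = ?h ** X + mscale t ((?h ** matrix_inv ?h) ** lie X A)"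
    by (simp only: matrix_add_ldistrib mscale_mult_right matrix_mul_assoc)
  also have "\<dots> = X ** ?h"
    unfolding matrix_inv_inverse[OF assms] matrix_mul_lid
    by (simp add: lie_def matrix_add_ldistrib matrix_add_rdistrib
        mscale_mult_left mscale_mult_right mscale_diff)
  finally show "X ** ?h = ?h ** ?Y"
    by simp
qed

text \<open>A bootstrap replaces the Neumann series: the identity \<open>B t = 1 - t A B t\<close>
  first bounds \<open>B\<close> near 0 and, once \<open>B\<close> is bounded, gives its
  limit.\<close>

lemma tendsto_inv_one_plus:
  fixes A :: "'n::finite cmat"
  shows "((\<lambda>t. matrix_inv (mat 1 + mscale t A)) \<longlongrightarrow> mat 1) (nhds (0::complex))"
proof -
  define B where "B t = matrix_inv (mat 1 + mscale t A)" for t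
  interpret M: bounded_bilinear "(**) :: 'n cmat \<Rightarrow> 'n cmat \<Rightarrow> 'n cmat"
    by (rule bounded_bilinear_matrix_mult)
  interpret S: bounded_bilinear "mscale :: complex \<Rightarrow> 'n cmat \<Rightarrow> 'n cmat"
    by (rule bounded_bilinear_mscale)
  have lim: "((\<lambda>t. mscale t A) \<longlongrightarrow> mscale 0 A) (nhds 0)"
    by (rule S.tendsto[OF _ tendsto_const]) (simp add: filterlim_ident)
  have B_eq: "\<forall>\<^sub>F t in nhds 0. B t = mat 1 - mscale t A ** B t"
    using eventually_invertible_one_plus[of A]
  proof eventually_elim
    case (elim t)
    have "B t + mscale t A ** B t = (mat 1 + mscale t A) ** B t"
      by (simp add: matrix_add_rdistrib)
    also have "\<dots> = mat 1"
      using matrix_inv_inverse(1)[OF elim] by (simp add: B_def)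
    finally show ?case
      by (metis eq_diff_eq)
  qed
  obtain K where K: "K > 0" "\<And>(a :: 'n cmat) (b :: 'n cmat). norm (a ** b) \<le> norm a * norm b * K"
    using M.pos_bounded by metis
  \<comment> \<open>The bound 1/(2K) makes the product term at most half of
    \<open>norm (B t)\<close>, so that it can be absorbed on the left.\<close>
  have small: "\<forall>\<^sub>F t in nhds 0. norm (mscale t A) < 1 / (2 * K)"
    using lim K(1) by (intro order_tendstoD(2)[OF tendsto_norm[OF lim]]) simp
  have bound: "\<forall>\<^sub>F t in nhds 0. norm (B t) \<le> 2 * norm (mat 1 :: 'n cmat)"
    using B_eq small
  proof eventually_elim
    case (elim t)
    have "norm (B t) \<le> norm (mat 1 :: 'n cmat) + norm (mscale t A ** B t)"
      by (subst elim(1)) (rule norm_triangle_ineq4)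
    also have "norm (mscale t A ** B t) \<le> norm (mscale t A) * norm (B t) * K"
      by (rule K)
    also have "\<dots> \<le> 1 / (2 * K) * norm (B t) * K"
      using elim(2) K(1) by (intro mult_right_mono) auto
    also have "\<dots> = norm (B t) / 2"
      using K(1) by simp
    finally show ?case
      by simp
  qed
  have "((\<lambda>t. mscale t A ** B t) \<longlongrightarrow> 0) (nhds 0)"
  proof (rule Lim_null_comparison)
    show "\<forall>\<^sub>F t in nhds 0. norm (mscale t A ** B t) \<le>
        norm (mscale t A) * (2 * norm (mat 1 :: 'n cmat)) * K"
      using bound
    proof eventually_elim
      case (elim t)
      have "norm (mscale t A ** B t) \<le> norm (mscale t A) * norm (B t) * K"
        by (rule K)
      also have "\<dots> \<le> norm (mscale t A) * (2 * norm (mat 1 :: 'n cmat)) * K"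
        using elim K(1) by (intro mult_right_mono mult_left_mono) auto
      finally show ?case .
    qed
    show "((\<lambda>t. norm (mscale t A) * (2 * norm (mat 1 :: 'n cmat)) * K) \<longlongrightarrow> 0) (nhds 0)"
      using tendsto_norm[OF lim] by (intro tendsto_mult_left_zero) simp
  qed
  then have "((\<lambda>t. mat 1 - mscale t A ** B t) \<longlongrightarrow> mat 1 - 0) (nhds 0)"
    by (intro tendsto_diff tendsto_const)
  then have "(B \<longlongrightarrow> mat 1) (nhds 0)"
    unfolding filterlim_cong[OF refl refl B_eq] by simp
  then show ?thesis
    by (simp add: B_def[abs_def])
qed

text \<open>\<open>has_derivative\<close> yields only real-linear maps; the clause on
  \<open>mscale\<close> supplies linearity over the complex numbers.\<close>

definition C_linear :: "('n::finite cmat \<Rightarrow> complex) \<Rightarrow> bool" where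
  "C_linear F \<longleftrightarrow> (\<forall>V W. F (V + W) = F V + F W) \<and> (\<forall>c V. F (mscale c V) = c * F V)"

lemma C_linear_mscale: "C_linear F \<Longrightarrow> F (mscale c V) = c * F V"
  and C_linear_add: "C_linear F \<Longrightarrow> F (V + W) = F V + F W"
  by (simp_all add: C_linear_def)

text \<open>By \<open>conj_act_one_plus\<close> the error term is
  \<open>mscale t (R t - lie X A)\<close>, and \<open>R\<close> tends to
  \<open>lie X A\<close>.\<close>

lemma curve_has_derivative:
  fixes X A :: "'n::finite cmat"
  shows "((\<lambda>t. conj_act X (mat 1 + mscale t A)) has_derivative (\<lambda>t. mscale t (lie X A))) (at 0)"
proof -
  define R where "R t = matrix_inv (mat 1 + mscale t A) ** lie X A" for t
  interpret M: bounded_bilinear "(**) :: 'n cmat \<Rightarrow> 'n cmat \<Rightarrow> 'n cmat"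
    by (rule bounded_bilinear_matrix_mult)
  interpret S: bounded_bilinear "mscale :: complex \<Rightarrow> 'n cmat \<Rightarrow> 'n cmat"
    by (rule bounded_bilinear_mscale)
  have R_lim: "(R \<longlongrightarrow> lie X A) (nhds 0)"
    using M.tendsto[OF tendsto_inv_one_plus tendsto_const, of A "lie X A"]
    by (simp add: R_def[abs_def])
  obtain K where K: "K > 0" "\<And>a (b :: 'n cmat). norm (mscale a b) \<le> norm a * norm b * K"
    using S.pos_bounded by metis
  let ?\<gamma> = "\<lambda>t. conj_act X (mat 1 + mscale t A)"
  have "((\<lambda>t. norm (?\<gamma> t - ?\<gamma> 0 - mscale (t - 0) (lie X A)) / norm (t - 0)) \<longlongrightarrow> 0) (at 0)"
  proof (rule Lim_null_comparison)
    have "\<forall>\<^sub>F t in at 0. invertible (mat 1 + mscale t A)"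
      using eventually_invertible_one_plus eventually_nhds_conv_at by blast
    then show "\<forall>\<^sub>F t in at 0. norm (norm (?\<gamma> t - ?\<gamma> 0 - mscale (t - 0) (lie X A)) / norm (t - 0))
        \<le> norm (R t - lie X A) * K"
    proof eventually_elim
      case (elim t)
      have "?\<gamma> t - ?\<gamma> 0 - mscale (t - 0) (lie X A) = mscale t (R t - lie X A)"
        by (simp add: conj_act_one_plus[OF elim] mscale_diff R_def)
      then show ?case
        using K(2)[of t "R t - lie X A"] K(1)
        by (cases "t = 0") (auto simp: field_simps)
    qed
    have "((\<lambda>t. R t - lie X A) \<longlongrightarrow> 0) (at 0)"
      using tendsto_mono[OF _ R_lim, of "at 0"] LIM_zero by (metis at_within_le_nhds)
    then show "((\<lambda>t. norm (R t - lie X A) * K) \<longlongrightarrow> 0) (at 0)"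
      by (intro tendsto_mult_left_zero tendsto_norm_zero)
  qed
  then show ?thesis
    unfolding has_derivative_iff_norm
    by (simp add: S.bounded_linear_left)
qed

text \<open>Near 0 the curve lies both in the orbit and in \<open>U\<close>, so \<open>f\<close> may
  be replaced by \<open>F\<close> and the chain rule applies. Compatibility of \<open>F'\<close>
  with complex scalars makes the real derivative of the composite a complex one.\<close>

lemma fund_deriv_extension:
  assumes Orb: "Orb = adj_orbit Z" and X: "X \<in> Orb" and U: "open U" "X \<in> U"
    and F: "(F has_derivative F') (at X)" "\<And>c V. F' (mscale c V) = c * F' V"
    and eq: "\<And>Y. Y \<in> U \<inter> Orb \<Longrightarrow> f Y = F Y"
  shows "fund_deriv A f X = F' (lie X A)"
proof -
  let ?\<gamma> = "\<lambda>t. conj_act X (mat 1 + mscale t A)"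
  have "((F \<circ> ?\<gamma>) has_derivative (F' \<circ> (\<lambda>t. mscale t (lie X A)))) (at 0)"
    by (rule diff_chain_at[OF curve_has_derivative]) (simp add: F(1))
  then have "((F \<circ> ?\<gamma>) has_field_derivative F' (lie X A)) (at 0)"
    by (simp add: has_field_derivative_def o_def F(2) mult_commute_abs)
  then have D: "deriv (F \<circ> ?\<gamma>) 0 = F' (lie X A)"
    by (rule DERIV_imp_deriv)
  have "isCont ?\<gamma> 0"
    using curve_has_derivative has_derivative_continuous by blast
  then have "(?\<gamma> \<longlongrightarrow> ?\<gamma> 0) (nhds 0)"
    unfolding isCont_def using tendsto_at_iff_tendsto_nhds by blast
  then have "\<forall>\<^sub>F t in nhds 0. ?\<gamma> t \<in> U"
    using U by (intro topological_tendstoD[of ?\<gamma> "?\<gamma> 0"]) simp_all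
  then have "\<forall>\<^sub>F t in nhds 0. f (?\<gamma> t) = F (?\<gamma> t)"
    using eventually_invertible_one_plus[of A]
  proof eventually_elim
    case (elim t)
    have "?\<gamma> t \<in> adj_orbit X"
      using elim(2) by (rule adj_orbitI)
    then show ?case
      using elim(1) eq adj_orbit_eq[of X Z] X Orb by auto
  qed
  then have "deriv (\<lambda>t. f (?\<gamma> t)) 0 = deriv (\<lambda>t. F (?\<gamma> t)) 0"
    by (intro deriv_cong_ev) auto
  then show ?thesis
    using D by (simp add: fund_deriv_def o_def)
qed

lemma fund_deriv_holo:
  assumes "Orb = adj_orbit Z" "X \<in> Orb" "f \<in> holo Orb"
  obtains F' where "C_linear F'" "\<And>A. fund_deriv A f X = F' (lie X A)"
proof -
  obtain U F where U: "open U" "X \<in> U"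
    and F: "\<forall>Y\<in>U. \<exists>F'. (F has_derivative F') (at Y) \<and> (\<forall>c V. F' (mscale c V) = c * F' V)"
    and eq: "\<forall>Y\<in>U \<inter> Orb. f Y = F Y"
    using assms(2,3) unfolding holo_def by blast
  obtain F' where F': "(F has_derivative F') (at X)" "\<forall>c V. F' (mscale c V) = c * F' V"
    using F U(2) by blast
  show ?thesis
  proof
    show "C_linear F'"
      using F' has_derivative_linear[OF F'(1)] by (simp add: C_linear_def linear_add)
    show "fund_deriv A f X = F' (lie X A)" for A
      using assms(1,2) U F' eq by (intro fund_deriv_extension[where U = U and F = F]) auto
  qed
qed

text \<open>Entries serve as the test functions that isolate single coefficients of a
  bivector.\<close>

lemma entry_holo: "(\<lambda>Y. Y $ i $ j) \<in> holo Orb"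
  unfolding holo_def
proof (intro CollectI ballI exI[of _ UNIV] exI[of _ "\<lambda>Y. Y $ i $ j"] exI conjI)
  fix X Y
  show "((\<lambda>Y. Y $ i $ j) has_derivative (\<lambda>Y. Y $ i $ j)) (at Y)"
    by (intro bounded_linear_imp_has_derivative
        bounded_linear_compose[OF bounded_linear_vec_nth bounded_linear_vec_nth])
qed auto

lemma fund_deriv_entry:
  assumes "X \<in> adj_orbit Z"
  shows "fund_deriv A (\<lambda>Y. Y $ i $ j) X = lie X A $ i $ j"
  by (rule fund_deriv_extension[OF refl assms open_UNIV UNIV_I])
     (auto intro!: bounded_linear_imp_has_derivative
        bounded_linear_compose[OF bounded_linear_vec_nth bounded_linear_vec_nth])

text \<open>Translation by \<open>g\<close> passes from the function to the direction, because
  \<open>g\<close> intertwines \<open>1 + t A\<close> with \<open>1 + t (conj_act A g)\<close>. This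
  evaluates the push-forward in \<open>invariant_field\<close>.\<close>

lemma fund_deriv_conj_act:
  assumes g: "invertible g"
  shows "fund_deriv A (\<lambda>Y. f (conj_act Y g)) L = fund_deriv (conj_act A g) f (conj_act L g)"
  unfolding fund_deriv_def
proof (rule deriv_cong_ev)
  show "\<forall>\<^sub>F t in nhds 0. f (conj_act (conj_act L (mat 1 + mscale t A)) g) =
      f (conj_act (conj_act L g) (mat 1 + mscale t (conj_act A g)))"
    using eventually_invertible_one_plus[of A] eventually_invertible_one_plus[of "conj_act A g"]
  proof eventually_elim
    case (elim t)
    have "mat 1 + mscale t (conj_act A g) = conj_act (mat 1 + mscale t A) g"
      by (simp add: conj_act_add conj_act_mscale conj_act_mat_one g)
    then have "g ** (mat 1 + mscale t (conj_act A g)) = (mat 1 + mscale t A) ** g"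
      by (simp add: mult_conj_act g)
    then show ?case
      by (simp add: conj_act_conj_act g elim)
  qed
qed simp

text \<open>Equivariance carries the curve through \<open>X\<close> to the curve through
  \<open>P X\<close> with the same \<open>A\<close>. Hence the action parts of the two brackets
  always correspond under \<open>P\<close>.\<close>

lemma fund_deriv_equivariant:
  assumes "equivariant_map Orb1 Orb2 P" "X \<in> Orb1"
  shows "fund_deriv A (f \<circ> P) X = fund_deriv A f (P X)"
  unfolding fund_deriv_def
proof (rule deriv_cong_ev)
  show "\<forall>\<^sub>F t in nhds 0. (f \<circ> P) (conj_act X (mat 1 + mscale t A)) =
      f (conj_act (P X) (mat 1 + mscale t A))"
    using eventually_invertible_one_plus[of A]
    by eventually_elim (use assms in \<open>simp add: equivariant_map_def\<close>)
qed simp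

section \<open>Diagonal base points and block data\<close>

definition diag_mat :: "('n::finite \<Rightarrow> complex) \<Rightarrow> 'n cmat" where
  "diag_mat d = (\<chi> i j. if i = j then d i else 0)"

lemma diag_mat_nth [simp]: "diag_mat d $ i $ j = (if i = j then d i else 0)"
  by (simp add: diag_mat_def)

lemma diag_mat_mult_nth [simp]:
  "(diag_mat d ** A) $ i $ j = d i * A $ i $ j"
  "(A ** diag_mat d) $ i $ j = A $ i $ j * d j"
  by (simp_all add: matrix_matrix_mult_nth if_distrib if_distribR cong: if_cong)

lemma diag_mat_inject: "diag_mat d = diag_mat e \<longleftrightarrow> d = e"
  by (auto simp: vec_eq_iff fun_eq_iff)

lemma diag_mat_mult: "diag_mat d ** diag_mat e = diag_mat (\<lambda>i. d i * e i)"
  by (simp add: vec_eq_iff)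

lemma lie_diag_munit: "lie (diag_mat d) (munit a) = mscale (d (fst a) - d (snd a)) (munit a)"
  by (auto simp: lie_def vec_eq_iff algebra_simps)

text \<open>By the convention \<open>x / 0 = 0\<close> the coefficient vanishes where \<open>d s = d t\<close>, that is, exactly
  on the matrix units of the stabilizer of \<open>diag d\<close>.\<close>

definition diag_pairing ::
    "('n::finite \<Rightarrow> complex) \<Rightarrow> complex \<Rightarrow> ('n \<times> 'n \<Rightarrow> complex) \<Rightarrow> ('n \<times> 'n \<Rightarrow> complex) \<Rightarrow> complex"
  where "diag_pairing d c l m =
    (\<Sum>s\<in>UNIV. \<Sum>t\<in>UNIV. (d s + d t + c) / (d s - d t) * l (s, t) * m (t, s))"

section \<open>The trace form and the invariance of its Casimir tensor\<close>

lemma sum_sum_delta: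
  fixes f :: "'a::finite \<Rightarrow> 'b::finite \<Rightarrow> complex"
  shows "(\<Sum>i\<in>UNIV. \<Sum>j\<in>UNIV. if i = a \<and> j = b then f i j else 0) = f a b"
proof -
  have "(\<Sum>j\<in>UNIV. if i = a \<and> j = b then f i j else 0) = (if i = a then f i b else 0)" for i
    by (cases "i = a") simp_all
  then show ?thesis
    by simp
qed

text \<open>Nondegeneracy of the trace form: \<open>\<Phi>\<close> is the gradient of
  \<open>F\<close>. Its indices are transposed because the trace of
  \<open>\<Phi> ** munit (j, i)\<close> is the entry \<open>\<Phi> $ i $ j\<close>.\<close>

lemma C_linear_eq_trace:
  assumes "C_linear F"
  obtains \<Phi> where "\<And>A. F A = trace (\<Phi> ** A)"
proof -
  define \<Phi> where "\<Phi> = (\<chi> i j. F (munit (j, i)))"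
  have F0: "F 0 = 0"
    using C_linear_mscale[OF assms, of 0 0] by simp
  have add: "F (sum g I) = (\<Sum>i\<in>I. F (g i))" if "finite I" for g and I :: "'a set"
    using that by (induction I rule: finite_induct) (simp_all add: F0 C_linear_add[OF assms])
  have "F A = trace (\<Phi> ** A)" for A
  proof -
    have "A = (\<Sum>i\<in>UNIV. \<Sum>j\<in>UNIV. mscale (A $ i $ j) (munit (i, j)))"
    proof -
      have "A $ i $ j * (if (a, b) = (i, j) then 1 else 0) = (if i = a \<and> j = b then A $ i $ j else 0)"
        for i j a b by simp
      then show ?thesis
        by (simp only: vec_eq_iff sum_component mscale_nth munit_nth sum_sum_delta) simp
    qed
    then have "F A = F (\<Sum>i\<in>UNIV. \<Sum>j\<in>UNIV. mscale (A $ i $ j) (munit (i, j)))"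
      by simp
    also have "\<dots> = (\<Sum>i\<in>UNIV. \<Sum>j\<in>UNIV. A $ i $ j * F (munit (i, j)))"
      by (simp add: add C_linear_mscale[OF assms])
    also have "\<dots> = trace (\<Phi> ** A)"
      unfolding trace_def matrix_matrix_mult_nth \<Phi>_def
      by (subst sum.swap) (simp add: mult.commute)
    finally show ?thesis .
  qed
  then show thesis
    by (rule that)
qed

lemma trace_mult_munit: "trace (A ** munit (s, t)) = A $ t $ s"
proof -
  have "(A ** munit (s, t)) $ i $ i = (if i = t then A $ i $ s else 0)" for i
    by (auto simp: matrix_matrix_mult_nth if_distrib cong: if_cong)
  then show ?thesis
    by (simp add: trace_def)
qed

lemma trace_mult_conj_act:
  "trace (A ** conj_act B g) = trace (g ** A ** matrix_inv g ** B)"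
proof -
  have "trace (A ** conj_act B g) = trace ((A ** matrix_inv g ** B) ** g)"
    by (simp add: conj_act_def matrix_mul_assoc)
  also have "\<dots> = trace (g ** (A ** matrix_inv g ** B))"
    by (rule trace_mul_sym)
  finally show ?thesis
    by (simp add: matrix_mul_assoc)
qed

text \<open>In terms of gradients the contraction over dual matrix units is
  \<open>trace (\<Phi> ** \<Psi>)\<close>, and conjugating both gradients leaves this trace
  unchanged. This makes the frame \<open>g\<close> disappear from the invariant bivector.\<close>

lemma casimir_invariant:
  assumes g: "invertible g" and F: "C_linear F" and H: "C_linear H"
  shows "(\<Sum>s\<in>UNIV. \<Sum>t\<in>UNIV. F (conj_act (munit (s, t)) g) * H (conj_act (munit (t, s)) g)) =
    (\<Sum>s\<in>UNIV. \<Sum>t\<in>UNIV. F (munit (s, t)) * H (munit (t, s)))"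
proof -
  obtain \<Phi> where \<Phi>: "\<And>A. F A = trace (\<Phi> ** A)"
    using C_linear_eq_trace[OF F] by blast
  obtain \<Psi> where \<Psi>: "\<And>A. H A = trace (\<Psi> ** A)"
    using C_linear_eq_trace[OF H] by blast
  have tr: "(\<Sum>s\<in>UNIV. \<Sum>t\<in>UNIV. trace (A ** munit (s, t)) * trace (B ** munit (t, s))) = trace (A ** B)"
    for A B :: "'a cmat"
    unfolding trace_mult_munit by (subst sum.swap) (simp add: trace_def matrix_matrix_mult_nth)
  let ?h = "matrix_inv g"
  have "(g ** \<Phi> ** ?h) ** (g ** \<Psi> ** ?h) = g ** \<Phi> ** (?h ** g) ** \<Psi> ** ?h"
    by (simp only: matrix_mul_assoc)
  also have "\<dots> = g ** (\<Phi> ** \<Psi> ** ?h)"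
    by (simp add: matrix_inv_inverse[OF g] matrix_mul_assoc)
  finally have "trace ((g ** \<Phi> ** ?h) ** (g ** \<Psi> ** ?h)) = trace ((\<Phi> ** \<Psi> ** ?h) ** g)"
    by (simp only: trace_mul_sym[of g])
  also have "\<dots> = trace (\<Phi> ** \<Psi>)"
    by (metis matrix_inv_inverse(2)[OF g] matrix_mul_assoc matrix_mul_rid)
  finally show ?thesis
    by (simp add: \<Phi> \<Psi> trace_mult_conj_act tr)
qed

lemma C_linear_lie: "C_linear F \<Longrightarrow> C_linear (\<lambda>A. F (lie Z A))"
proof -
  assume F: "C_linear F"
  have "lie Z (V + W) = lie Z V + lie Z W" "lie Z (mscale c V) = mscale c (lie Z V)" for V W c
    by (simp_all add: lie_def matrix_add_ldistrib matrix_add_rdistrib mscale_mult_left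
        mscale_mult_right mscale_diff)
  then show ?thesis
    using F by (simp add: C_linear_def)
qed

text \<open>The right-hand side is the pairing of two differentials with the quadratic bivector
  \<open>tr((X\<^sup>2 + c X) [df, dh])\<close>, which refers to \<open>X\<close> only.\<close>

lemma diag_pairing_intrinsic:
  assumes g: "invertible g" and X: "X = conj_act (diag_mat d) g"
    and F: "C_linear F" and H: "C_linear H"
  shows "diag_pairing d c (\<lambda>a. F (lie X (conj_act (munit a) g))) (\<lambda>a. H (lie X (conj_act (munit a) g))) =
    - (\<Sum>s\<in>UNIV. \<Sum>t\<in>UNIV. F (lie (X ** X + mscale c X) (munit (s, t))) * H (munit (t, s)))"
proof -
  let ?Ad = "\<lambda>a. conj_act (munit a) g"
  define Z where "Z = X ** X + mscale c X"
  \<comment> \<open>A polynomial in \<open>X\<close> is diagonalised by the same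
    \<open>g\<close>.\<close>
  have Z: "Z = conj_act (diag_mat (\<lambda>i. d i * d i + c * d i)) g"
  proof -
    have "diag_mat (\<lambda>i. d i * d i + c * d i) = diag_mat d ** diag_mat d + mscale c (diag_mat d)"
      by (simp add: vec_eq_iff)
    then show ?thesis
      by (simp add: Z_def X conj_act_add conj_act_mult[OF g] conj_act_mscale)
  qed
  have lieX: "lie X (?Ad (s, t)) = mscale (d s - d t) (?Ad (s, t))" for s t
    by (simp add: X conj_act_lie[OF g, symmetric] lie_diag_munit conj_act_mscale)
  have lieZ: "lie Z (?Ad (s, t)) = mscale (d s * d s + c * d s - (d t * d t + c * d t)) (?Ad (s, t))" for s t
    by (simp add: Z conj_act_lie[OF g, symmetric] lie_diag_munit conj_act_mscale)
  \<comment> \<open>The numerator times \<open>d s - d t\<close> is the difference of the values of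
    \<open>x * x + c * x\<close> at \<open>d s\<close> and \<open>d t\<close>; the minus sign comes
    from the factor \<open>d t - d s\<close> of the second covector. For \<open>d s = d t\<close>
    the left side is 0 as a division by zero, the right side because \<open>lie Z\<close> kills this
    matrix unit.\<close>
  have "(d s + d t + c) / (d s - d t) * F (lie X (?Ad (s, t))) * H (lie X (?Ad (t, s))) =
      - (F (lie Z (?Ad (s, t))) * H (?Ad (t, s)))" for s t
  proof (cases "d s = d t")
    case True
    then show ?thesis
      using C_linear_mscale[OF F, of 0 0] by (simp add: lieZ)
  next
    case False
    then have "(d s + d t + c) / (d s - d t) * F (lie X (?Ad (s, t))) * H (lie X (?Ad (t, s))) =
      (d s + d t + c) * F (?Ad (s, t)) * ((d t - d s) * H (?Ad (t, s)))"
      by (simp add: lieX C_linear_mscale[OF F] C_linear_mscale[OF H])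
    then show ?thesis
      by (simp add: lieZ C_linear_mscale[OF F] algebra_simps)
  qed
  then have "diag_pairing d c (\<lambda>a. F (lie X (?Ad a))) (\<lambda>a. H (lie X (?Ad a))) =
     - (\<Sum>s\<in>UNIV. \<Sum>t\<in>UNIV. F (lie Z (?Ad (s, t))) * H (?Ad (t, s)))"
    by (simp add: diag_pairing_def sum_negf)
  then show ?thesis
    using casimir_invariant[OF g C_linear_lie[OF F] H] by (simp add: Z_def)
qed

section \<open>Diagonal matrices encoded by block lists\<close>

definition block_value :: "(complex \<times> nat) list \<Rightarrow> 'n::{finite,linorder} \<Rightarrow> complex" where
  "block_value bs i = concat (map (\<lambda>(c, m). replicate m c) bs) ! rank_of i"

lemma block_diag_eq: "block_diag bs = diag_mat (block_value bs)"
  by (simp add: vec_eq_iff block_diag_def block_value_def)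

lemma inj_rank_of: "inj (rank_of :: 'n::{finite,linorder} \<Rightarrow> nat)"
proof -
  have "rank_of i < rank_of j" if "i < j" for i j :: 'n
    unfolding rank_of_def using that by (intro psubset_card_mono) auto
  then show ?thesis
    by (intro injI) (metis less_irrefl linorder_neqE)
qed

lemma rank_of_less: "rank_of (i :: 'n::{finite,linorder}) < CARD('n)"
  unfolding rank_of_def by (intro psubset_card_mono) auto

lemma bij_rank_of: "bij_betw (rank_of :: 'n::{finite,linorder} \<Rightarrow> nat) UNIV {..<CARD('n)}"
proof -
  have "rank_of ` (UNIV :: 'n set) = {..<CARD('n)}"
    by (intro card_subset_eq) (auto simp: rank_of_less card_image[OF inj_rank_of])
  then show ?thesis
    using inj_rank_of by (simp add: bij_betw_def)
qed

lemma concat_replicate_nth: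
  assumes "p < length bs" "sum_list (map snd (take p bs)) \<le> r"
    "r < sum_list (map snd (take (Suc p) bs))"
  shows "concat (map (\<lambda>(c, m). replicate m c) bs) ! r = fst (bs ! p)"
  using assms
proof (induction bs arbitrary: p r)
  case (Cons b bs)
  obtain c m where b: "b = (c, m)"
    by fastforce
  show ?case
  proof (cases p)
    case 0
    then show ?thesis
      using Cons.prems by (simp add: b nth_append)
  next
    case (Suc q)
    then show ?thesis
      using Cons.prems Cons.IH[of q "r - m"] by (auto simp: b nth_append)
  qed
qed simp

lemma exists_block:
  fixes bs :: "(complex \<times> nat) list"
  assumes "r < sum_list (map snd bs)"
  shows "\<exists>p<length bs. sum_list (map snd (take p bs)) \<le> r \<and> r < sum_list (map snd (take (Suc p) bs))"
proof -
  \<comment> \<open>The first block whose end lies beyond \<open>r\<close>; by minimality the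
    preceding block ends at or before \<open>r\<close>.\<close>
  define p where "p = (LEAST p. r < sum_list (map snd (take (Suc p) bs)))"
  have ex: "r < sum_list (map snd (take (Suc (length bs - 1)) bs))"
    using assms by (cases bs) auto
  have p: "r < sum_list (map snd (take (Suc p) bs))"
    unfolding p_def using ex by (rule LeastI)
  have "p \<le> length bs - 1"
    unfolding p_def using ex by (rule Least_le)
  moreover have "sum_list (map snd (take p bs)) \<le> r"
  proof (cases p)
    case (Suc q)
    then have "\<not> r < sum_list (map snd (take (Suc q) bs))"
      using not_less_Least[of q "\<lambda>p. r < sum_list (map snd (take (Suc p) bs))"]
      unfolding p_def by simp
    then show ?thesis
      by (simp add: Suc)
  qed simp
  moreover have "bs \<noteq> []"
    using assms by auto
  ultimately show ?thesis
    using p by (intro exI[of _ p]) (cases bs; auto)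
qed

lemma block_value_block_indices:
  assumes "p < length bs" "i \<in> block_indices bs p"
  shows "block_value bs i = fst (bs ! p)"
  using assms by (simp add: block_value_def block_indices_def concat_replicate_nth)

lemma ex1_block_indices:
  assumes "valid_blocks TYPE('n) bs"
  shows "\<exists>!p. p < length bs \<and> (i :: 'n::{finite,linorder}) \<in> block_indices bs p"
proof -
  have "rank_of i < sum_list (map snd bs)"
    using assms rank_of_less[of i] by (simp add: valid_blocks_def)
  then obtain p where p: "p < length bs" "i \<in> block_indices bs p"
    using exists_block by (auto simp: block_indices_def)
  have "p = q" if "q < length bs" "i \<in> block_indices bs q" for q
  proof -
    \<comment> \<open>Two blocks containing \<open>i\<close> share their eigenvalue, and the
      eigenvalues in the list are distinct.\<close>
    have "map fst bs ! p = map fst bs ! q"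
      using p that block_value_block_indices by (metis nth_map)
    then show ?thesis
      using assms p(1) that(1) by (simp add: valid_blocks_def distinct_conv_nth) metis
  qed
  with p show ?thesis
    by blast
qed

lemma sum_block_indices:
  fixes f :: "'n::{finite,linorder} \<Rightarrow> complex"
  assumes "valid_blocks TYPE('n) bs"
  shows "(\<Sum>i\<in>UNIV. f i) = (\<Sum>p<length bs. \<Sum>i\<in>block_indices bs p. f i)"
proof -
  have disj: "block_indices bs p \<inter> block_indices bs q = ({} :: 'n set)"
    if "p < length bs" "q < length bs" "p \<noteq> q" for p q
    using ex1_block_indices[OF assms] that by (metis disjoint_iff)
  have "(\<Sum>p<length bs. \<Sum>i\<in>block_indices bs p. f i) = sum f (\<Union>p\<in>{..<length bs}. block_indices bs p)"
    by (rule sum.UNION_disjoint[symmetric]) (simp_all add: disj)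
  also have "i \<in> (\<Union>p\<in>{..<length bs}. block_indices bs p)" for i :: 'n
    using ex1_block_indices[OF assms, of i] by auto
  then have "(\<Union>p\<in>{..<length bs}. block_indices bs p) = (UNIV :: 'n set)"
    by auto
  finally show ?thesis
    by simp
qed

section \<open>Pairing of tensors with covectors, and the invariant field\<close>

definition tensor_pairing ::
    "'n::finite tens2 \<Rightarrow> ('n \<times> 'n \<Rightarrow> complex) \<Rightarrow> ('n \<times> 'n \<Rightarrow> complex) \<Rightarrow> complex" where
  "tensor_pairing T l m = (\<Sum>a\<in>UNIV. \<Sum>b\<in>UNIV. T a b * l a * m b)"

lemma tensor_pairing_add:
  "tensor_pairing (\<lambda>a b. S a b + T a b) l m = tensor_pairing S l m + tensor_pairing T l m"
  by (simp add: tensor_pairing_def sum.distrib distrib_right)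

lemma tensor_pairing_scale: "tensor_pairing (\<lambda>a b. c * T a b) l m = c * tensor_pairing T l m"
  by (simp only: tensor_pairing_def sum_distrib_left mult.assoc)

lemma tensor_pairing_sum:
  "tensor_pairing (\<lambda>a b. \<Sum>i\<in>I. T i a b) l m = (\<Sum>i\<in>I. tensor_pairing (T i) l m)"
proof -
  have "tensor_pairing (\<lambda>a b. \<Sum>i\<in>I. T i a b) l m =
    (\<Sum>a\<in>UNIV. \<Sum>b\<in>UNIV. \<Sum>i\<in>I. T i a b * l a * m b)"
    by (simp only: tensor_pairing_def sum_distrib_right)
  also have "\<dots> = (\<Sum>a\<in>UNIV. \<Sum>i\<in>I. \<Sum>b\<in>UNIV. T i a b * l a * m b)"
    by (rule sum.cong[OF refl], rule sum.swap)
  also have "\<dots> = (\<Sum>i\<in>I. \<Sum>a\<in>UNIV. \<Sum>b\<in>UNIV. T i a b * l a * m b)"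
    by (rule sum.swap)
  finally show ?thesis
    by (simp only: tensor_pairing_def)
qed

lemma tensor_pairing_wedge:
  "tensor_pairing (wedge (munit x) (munit y)) l m = l x * m y - l y * m x"
proof -
  have munit: "munit z $ fst a $ snd a = (if a = z then 1 else 0)" for z a :: "'a \<times> 'a"
    by simp
  have if_mult: "(if p then 1 else 0) * (if q then 1 else 0) * u * v = (if p \<and> q then u * v else 0)"
    for p q and u v :: complex
    by simp
  have "wedge (munit x) (munit y) a b * l a * m b =
      (if a = x \<and> b = y then l a * m b else 0) - (if a = y \<and> b = x then l a * m b else 0)" for a b
    by (simp only: wedge_def case_prod_beta munit left_diff_distrib if_mult)
  then show ?thesis
    by (simp only: tensor_pairing_def sum_subtractf sum_sum_delta)
qed

text \<open>Folds a sum over all ordered pairs into the range \<open>p < q\<close> used in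
  \<open>kappa\<close> and \<open>s0\<close>.\<close>

lemma sum_square_eq_triangle:
  fixes K :: "nat \<Rightarrow> nat \<Rightarrow> complex"
  assumes "\<And>p. K p p = 0"
  shows "(\<Sum>p<N. \<Sum>q<N. K p q) = (\<Sum>q<N. \<Sum>p<q. K p q + K q p)"
  by (induction N) (simp_all add: sum.distrib assms)

text \<open>The coefficient is antisymmetric in the two blocks, and so is the wedge; the sum over
  \<open>p < q\<close> therefore unfolds to one over all ordered pairs of blocks, and then of
  indices.\<close>

lemma tensor_pairing_s_tensor:
  fixes l m :: "'n::{finite,linorder} \<times> 'n \<Rightarrow> complex"
  assumes bs: "valid_blocks TYPE('n) bs"
  shows "tensor_pairing (s_tensor bs c) l m = diag_pairing (block_value bs) c l m"
proof -
  let ?x = "\<lambda>p. fst (bs ! p)"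
  let ?co = "\<lambda>p q. (?x p + ?x q + c) / (?x p - ?x q)"
  define M where "M p q = (\<Sum>s\<in>block_indices bs p. \<Sum>t\<in>block_indices bs q. l (s, t) * m (t, s))" for p q
  have xi: "tensor_pairing (xi bs p q) l m = M p q - M q p" for p q
  proof -
    have "tensor_pairing (xi bs p q) l m =
      (\<Sum>s\<in>block_indices bs p. \<Sum>t\<in>block_indices bs q. l (s, t) * m (t, s) - l (t, s) * m (s, t))"
      by (simp add: xi_def tensor_pairing_sum tensor_pairing_wedge)
    also have "\<dots> = M p q - (\<Sum>s\<in>block_indices bs p. \<Sum>t\<in>block_indices bs q. l (t, s) * m (s, t))"
      by (simp add: M_def sum_subtractf)
    also have "\<dots> = M p q - M q p"
      unfolding M_def by (subst sum.swap) simp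
    finally show ?thesis .
  qed
  have coef: "(x + y) / (x - y) * z + c * (1 / (x - y) * z) = (x + y + c) / (x - y) * z"
    for x y z
    by (simp add: add_divide_distrib distrib_right)
  have "tensor_pairing (s_tensor bs c) l m =
    (\<Sum>q<length bs. \<Sum>p<q. ((?x p + ?x q) / (?x p - ?x q)) * (M p q - M q p)) +
     c * (\<Sum>q<length bs. \<Sum>p<q. 1 / (?x p - ?x q) * (M p q - M q p))"
    by (simp only: s_tensor_def s0_def kappa_def tensor_pairing_add tensor_pairing_scale
        tensor_pairing_sum xi)
  also have "\<dots> = (\<Sum>q<length bs. \<Sum>p<q. ?co p q * (M p q - M q p))"
    by (simp only: sum_distrib_left sum.distrib[symmetric] coef)
  also have "\<dots> = (\<Sum>q<length bs. \<Sum>p<q. ?co p q * M p q + ?co q p * M q p)"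
  proof (intro sum.cong refl)
    fix p q
    have "?co q p = - ?co p q"
      by (metis add.commute divide_minus_right minus_diff_eq)
    then show "?co p q * (M p q - M q p) = ?co p q * M p q + ?co q p * M q p"
      by (simp add: right_diff_distrib)
  qed
  \<comment> \<open>Diagonal terms vanish, since division by their zero denominator yields
    0.\<close>
  also have "\<dots> = (\<Sum>p<length bs. \<Sum>q<length bs. ?co p q * M p q)"
    by (rule sum_square_eq_triangle[symmetric]) simp
  also have "\<dots> = (\<Sum>p<length bs. \<Sum>s\<in>block_indices bs p. \<Sum>q<length bs. \<Sum>t\<in>block_indices bs q.
      (block_value bs s + block_value bs t + c) / (block_value bs s - block_value bs t)
        * l (s, t) * m (t, s))"
  proof (intro sum.cong refl)
    fix p assume "p \<in> {..<length bs}"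
    then have p: "block_value bs s = ?x p" if "s \<in> block_indices bs p" for s :: 'n
      using that block_value_block_indices by auto
    have "(\<Sum>q<length bs. ?co p q * M p q) =
      (\<Sum>q<length bs. \<Sum>s\<in>block_indices bs p. \<Sum>t\<in>block_indices bs q.
        ?co p q * l (s, t) * m (t, s))"
      by (simp add: M_def sum_distrib_left mult.assoc)
    also have "\<dots> = (\<Sum>s\<in>block_indices bs p. \<Sum>q<length bs. \<Sum>t\<in>block_indices bs q.
        ?co p q * l (s, t) * m (t, s))"
      by (rule sum.swap)
    also have "\<dots> = (\<Sum>s\<in>block_indices bs p. \<Sum>q<length bs. \<Sum>t\<in>block_indices bs q.
      (block_value bs s + block_value bs t + c) / (block_value bs s - block_value bs t)
        * l (s, t) * m (t, s))"
      by (intro sum.cong refl) (simp add: p block_value_block_indices)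
    finally show "(\<Sum>q<length bs. ?co p q * M p q) = \<dots>" .
  qed
  also have "\<dots> = diag_pairing (block_value bs) c l m"
    unfolding diag_pairing_def by (simp only: sum_block_indices[OF bs])
  finally show ?thesis .
qed

lemma bivector_at_eq:
  "bivector_at T X f h = tensor_pairing T (\<lambda>a. fund_deriv (munit a) f X) (\<lambda>a. fund_deriv (munit a) h X)"
  by (simp add: bivector_at_def tensor_pairing_def)

text \<open>Removes every choice from the field: \<open>bs\<close> and the element picked by
  \<open>SOME\<close> may be replaced by any diagonal point \<open>d\<close> of the orbit, in any
  order of entries, and any \<open>g\<close> carrying it to \<open>X\<close>.\<close>

lemma invariant_field_eq:
  fixes f h :: "'n::{finite,linorder} cmat \<Rightarrow> complex"
  assumes bs: "block_base Orb bs" and Orb: "Orb = adj_orbit Z"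
    and d: "diag_mat d \<in> Orb" and g: "invertible g" and X: "X = conj_act (diag_mat d) g"
    and f: "f \<in> holo Orb" and h: "h \<in> holo Orb"
  shows "invariant_field (block_diag bs) (s_tensor bs c) f h X =
    diag_pairing d c (\<lambda>a. fund_deriv (conj_act (munit a) g) f X)
      (\<lambda>a. fund_deriv (conj_act (munit a) g) h X)"
proof -
  define L :: "'n cmat" where "L = block_diag bs"
  have L: "L = diag_mat (block_value bs)" "L \<in> Orb" and valid: "valid_blocks TYPE('n) bs"
    using bs by (auto simp: L_def block_base_def block_diag_eq)
  have XO: "X \<in> Orb"
    using adj_orbitI[OF g, of "diag_mat d"] d Orb adj_orbit_eq X by metis
  then have "X \<in> adj_orbit L"
    using L(2) Orb adj_orbit_eq by metis
  then have ex: "\<exists>g. invertible g \<and> X = conj_act L g"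
    by (auto simp: adj_orbit_def)
  define k where "k = (SOME g. invertible g \<and> X = conj_act L g)"
  have k: "invertible k" "X = conj_act L k"
    using someI_ex[OF ex] by (auto simp: k_def)
  obtain F where F: "C_linear F" "\<And>A. fund_deriv A f X = F (lie X A)"
    using fund_deriv_holo[OF Orb XO f] by blast
  obtain H where H: "C_linear H" "\<And>A. fund_deriv A h X = H (lie X A)"
    using fund_deriv_holo[OF Orb XO h] by blast
  have "invariant_field (block_diag bs) (s_tensor bs c) f h X =
      bivector_at (s_tensor bs c) L (\<lambda>Y. f (conj_act Y k)) (\<lambda>Y. h (conj_act Y k))"
    by (simp add: invariant_field_def k_def Let_def L_def)
  also have "\<dots> = diag_pairing (block_value bs) c (\<lambda>a. F (lie X (conj_act (munit a) k)))
      (\<lambda>a. H (lie X (conj_act (munit a) k)))"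
    by (simp add: bivector_at_eq tensor_pairing_s_tensor[OF valid] fund_deriv_conj_act[OF k(1)]
        k(2)[symmetric] F(2) H(2))
  \<comment> \<open>Both sides equal the intrinsic expression at \<open>X\<close>, which mentions
    neither the frame nor the order of the eigenvalues.\<close>
  also have "\<dots> = diag_pairing d c (\<lambda>a. F (lie X (conj_act (munit a) g)))
      (\<lambda>a. H (lie X (conj_act (munit a) g)))"
    using diag_pairing_intrinsic[OF k(1) _ F(1) H(1), of X "block_value bs" c] k(2) L(1)
      diag_pairing_intrinsic[OF g X F(1) H(1), of c] by simp
  finally show ?thesis
    by (simp add: F(2) H(2))
qed

section \<open>Equivariant maps\<close>

text \<open>Models substitution of a matrix into a polynomial \<open>\<phi>\<close> through three
  properties: holomorphy, equivariance under conjugation, and entrywise action on diagonal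
  matrices.\<close>

definition matrix_function :: "('n::finite cmat \<Rightarrow> 'n cmat) \<Rightarrow> (complex \<Rightarrow> complex) \<Rightarrow> bool" where
  "matrix_function G \<phi> \<longleftrightarrow>
     (\<forall>Y. \<exists>G'. (G has_derivative G') (at Y) \<and> (\<forall>c V. G' (mscale c V) = mscale c (G' V))) \<and>
     (\<forall>g X. invertible g \<longrightarrow> G (conj_act X g) = conj_act (G X) g) \<and>
     (\<forall>d. G (diag_mat d) = diag_mat (\<lambda>i. \<phi> (d i)))"

lemma matrix_function_const: "matrix_function (\<lambda>X. mscale c (mat 1)) (\<lambda>x. c)"
  unfolding matrix_function_def
proof (intro conjI allI impI)
  fix Y show "\<exists>G'. ((\<lambda>X. mscale c (mat 1)) has_derivative G') (at Y) \<and>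
      (\<forall>c V. G' (mscale c V) = mscale c (G' V))"
    by (intro exI[of _ "\<lambda>V. 0"] conjI) (auto simp: vec_eq_iff)
qed (simp_all add: conj_act_mscale conj_act_mat_one, simp add: vec_eq_iff mat_def)

lemma matrix_function_ident: "matrix_function (\<lambda>X. X) (\<lambda>x. x)"
  unfolding matrix_function_def by (auto intro: has_derivative_ident)

lemma matrix_function_add:
  assumes "matrix_function G \<phi>" "matrix_function H \<psi>"
  shows "matrix_function (\<lambda>X. G X + H X) (\<lambda>x. \<phi> x + \<psi> x)"
  unfolding matrix_function_def
proof (intro conjI allI impI)
  fix Y
  obtain G' H' where "(G has_derivative G') (at Y)" "\<forall>c V. G' (mscale c V) = mscale c (G' V)"
    "(H has_derivative H') (at Y)" "\<forall>c V. H' (mscale c V) = mscale c (H' V)"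
    using assms unfolding matrix_function_def by meson
  then show "\<exists>F'. ((\<lambda>X. G X + H X) has_derivative F') (at Y) \<and>
      (\<forall>c V. F' (mscale c V) = mscale c (F' V))"
    by (intro exI[of _ "\<lambda>V. G' V + H' V"] conjI has_derivative_add) (auto simp: mscale_add)
qed (use assms in \<open>auto simp: matrix_function_def conj_act_add vec_eq_iff\<close>)

lemma matrix_function_mult:
  assumes "matrix_function G \<phi>" "matrix_function H \<psi>"
  shows "matrix_function (\<lambda>X. G X ** H X) (\<lambda>x. \<phi> x * \<psi> x)"
  unfolding matrix_function_def
proof (intro conjI allI impI)
  fix Y
  obtain G' H' where "(G has_derivative G') (at Y)" "\<forall>c V. G' (mscale c V) = mscale c (G' V)"
    "(H has_derivative H') (at Y)" "\<forall>c V. H' (mscale c V) = mscale c (H' V)"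
    using assms unfolding matrix_function_def by meson
  then show "\<exists>F'. ((\<lambda>X. G X ** H X) has_derivative F') (at Y) \<and>
      (\<forall>c V. F' (mscale c V) = mscale c (F' V))"
    by (intro exI[of _ "\<lambda>V. G Y ** H' V + G' V ** H Y"] conjI
        bounded_bilinear.FDERIV[OF bounded_bilinear_matrix_mult])
      (auto simp: mscale_add mscale_mult_left mscale_mult_right)
qed (use assms in \<open>auto simp: matrix_function_def conj_act_mult diag_mat_mult\<close>)

text \<open>Witness: the product of the factors \<open>X - c\<close> over \<open>c\<close> in
  \<open>S\<close>.\<close>

lemma matrix_function_vanishing:
  assumes "finite S"
  shows "\<exists>(G :: 'n::finite cmat \<Rightarrow> 'n cmat) \<phi>. matrix_function G \<phi> \<and> (\<forall>x. \<phi> x = 0 \<longleftrightarrow> x \<in> S)"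
  using assms
proof (induction S)
  case empty
  show ?case
    by (intro exI conjI) (rule matrix_function_const[of 1], simp)
next
  case (insert c S)
  then obtain G :: "'n cmat \<Rightarrow> 'n cmat" and \<phi> where G: "matrix_function G \<phi>" "\<forall>x. \<phi> x = 0 \<longleftrightarrow> x \<in> S"
    by blast
  have "matrix_function (\<lambda>X. (X + mscale (- c) (mat 1)) ** G X) (\<lambda>x. (x + - c) * \<phi> x)"
    by (intro matrix_function_mult matrix_function_add matrix_function_ident
        matrix_function_const G(1))
  then show ?case
    using G(2) by (intro exI conjI) (assumption, auto)
qed

text \<open>Newton interpolation: each new node \<open>c\<close> is corrected by a multiple of a
  function that vanishes exactly at the earlier nodes.\<close>

lemma matrix_function_interpolation:
  assumes "finite S"
  shows "\<exists>(G :: 'n::finite cmat \<Rightarrow> 'n cmat) \<psi>. matrix_function G \<psi> \<and> (\<forall>x\<in>S. \<psi> x = \<phi> x)"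
  using assms
proof (induction S)
  case empty
  show ?case
    using matrix_function_ident by blast
next
  case (insert c S)
  then obtain G :: "'n cmat \<Rightarrow> 'n cmat" and \<psi> where G: "matrix_function G \<psi>" "\<forall>x\<in>S. \<psi> x = \<phi> x"
    by blast
  obtain H :: "'n cmat \<Rightarrow> 'n cmat" and \<zeta> where H: "matrix_function H \<zeta>" "\<forall>x. \<zeta> x = 0 \<longleftrightarrow> x \<in> S"
    using matrix_function_vanishing[OF insert(1)] by blast
  \<comment> \<open>The denominator is nonzero since \<open>c\<close> is not in
    \<open>S\<close>.\<close>
  define k where "k = (\<phi> c - \<psi> c) / \<zeta> c"
  have "matrix_function (\<lambda>X. G X + mscale k (mat 1) ** H X) (\<lambda>x. \<psi> x + k * \<zeta> x)"
    by (intro matrix_function_mult matrix_function_add matrix_function_const G(1) H(1))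
  moreover have "\<forall>x\<in>insert c S. \<psi> x + k * \<zeta> x = \<phi> x"
    using G(2) H(2) insert(2) by (simp add: k_def)
  ultimately show ?case
    by blast
qed

text \<open>If \<open>E\<close> commutes with \<open>L\<close>, then \<open>1 + c E\<close> fixes
  \<open>L\<close> and, by equivariance, also \<open>P L\<close>; cancelling the identity part
  leaves commutation with \<open>E\<close>.\<close>

lemma equivariant_commute:
  assumes P: "equivariant_map Orb1 Orb2 P" and L: "L \<in> Orb1" and E: "lie L E = 0"
  shows "lie (P L) E = 0"
proof -
  \<comment> \<open>The factor \<open>c\<close> is cancelled at the end, hence the punctured
    neighbourhood.\<close>
  have "\<forall>\<^sub>F t in at 0. t \<noteq> 0 \<and> invertible (mat 1 + mscale t E)"
    using eventually_invertible_one_plus[of E]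
    by (simp add: eventually_conj_iff eventually_nhds_conv_at eventually_neq_at_within)
  then obtain c where c: "c \<noteq> 0" "invertible (mat 1 + mscale c E)"
    using eventually_happens' at_neq_bot by blast
  have "conj_act L (mat 1 + mscale c E) = L"
    using E by (intro conj_act_eqI[OF c(2)])
      (simp add: lie_def matrix_add_ldistrib matrix_add_rdistrib mscale_mult_left mscale_mult_right)
  then have "conj_act (P L) (mat 1 + mscale c E) = P L"
    using P L c(2) unfolding equivariant_map_def by metis
  then have "(mat 1 + mscale c E) ** P L = P L ** (mat 1 + mscale c E)"
    using mult_conj_act[OF c(2), of "P L"] by simp
  then have "mscale c (E ** P L) = mscale c (P L ** E)"
    by (simp add: matrix_add_ldistrib matrix_add_rdistrib mscale_mult_left mscale_mult_right)
  then show ?thesis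
    using c(1) by (simp add: lie_def vec_eq_iff)
qed

text \<open>The matrices commuting with \<open>diag_mat d\<close> include all diagonal matrix units
  and those \<open>munit (s, t)\<close> with \<open>d s = d t\<close>. Commuting with the former
  kills off-diagonal entries of the image; commuting with the latter equates diagonal ones.\<close>

lemma equivariant_diag:
  assumes P: "equivariant_map Orb1 Orb2 P" and L: "diag_mat d \<in> Orb1"
  obtains e where "P (diag_mat d) = diag_mat e" "\<And>s t. d s = d t \<Longrightarrow> e s = e t"
proof -
  define N where "N = P (diag_mat d)"
  have comm: "(N ** munit (s, t)) $ i $ j = (munit (s, t) ** N) $ i $ j" if "d s = d t" for s t i j
  proof -
    have "lie (diag_mat d) (munit (s, t)) = 0"
      by (simp add: lie_diag_munit that)
    then have "lie N (munit (s, t)) = 0"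
      unfolding N_def by (rule equivariant_commute[OF P L])
    then show ?thesis
      by (simp add: lie_def)
  qed
  have right: "(N ** munit (s, t)) $ i $ j = (if j = t then N $ i $ s else 0)" for s t i j
    by (auto simp: matrix_matrix_mult_nth if_distrib cong: if_cong)
  have left: "(munit (s, t) ** N) $ i $ j = (if i = s then N $ t $ j else 0)" for s t i j
    by (auto simp: matrix_matrix_mult_nth if_distrib if_distribR cong: if_cong)
  define e where "e i = N $ i $ i" for i
  have "N $ i $ s = 0" if "i \<noteq> s" for i s
    using comm[of s s i s] that unfolding left right by simp
  then have "N = diag_mat e"
    by (simp add: vec_eq_iff e_def)
  moreover have "e s = e t" if "d s = d t" for s t
    using comm[OF that, of s t] unfolding left right by (simp add: e_def)
  ultimately show thesis
    unfolding N_def by (rule that)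
qed

text \<open>On the orbit \<open>P\<close> agrees with a map \<open>G\<close> that is holomorphic on
  all matrices, so local extensions of \<open>f\<close> pull back along \<open>G\<close>. Thus
  equivariance alone gives the holomorphy clause of \<open>poisson_map\<close>.\<close>

lemma equivariant_compose_holo:
  fixes P :: "'n::finite cmat \<Rightarrow> 'n cmat"
  assumes P: "equivariant_map Orb1 Orb2 P" and Orb1: "Orb1 = adj_orbit (diag_mat d)"
    and f: "f \<in> holo Orb2"
  shows "f \<circ> P \<in> holo Orb1"
proof -
  have L: "diag_mat d \<in> Orb1"
    by (simp add: Orb1 self_mem_adj_orbit)
  obtain e where e: "P (diag_mat d) = diag_mat e" "\<And>s t. d s = d t \<Longrightarrow> e s = e t"
    using equivariant_diag[OF P L] by blast
  \<comment> \<open>Well defined because \<open>e\<close> is a function of \<open>d\<close>;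
    \<open>G\<close> only has to realise \<open>\<phi>\<close> on the finite set
    \<open>range d\<close>.\<close>
  define \<phi> where "\<phi> x = e (SOME s. d s = x)" for x
  have \<phi>: "\<phi> (d s) = e s" for s
    unfolding \<phi>_def by (rule e(2)) (rule someI[of _ s], simp)
  obtain G :: "'n cmat \<Rightarrow> 'n cmat" and \<psi> where G: "matrix_function G \<psi>" and \<psi>: "\<forall>x\<in>range d. \<psi> x = \<phi> x"
    using matrix_function_interpolation[of "range d" \<phi>] by auto
  have G_conj: "G (conj_act X g) = conj_act (G X) g" if "invertible g" for X g
    using G that by (simp add: matrix_function_def)
  have GP: "P X = G X" if X: "X \<in> Orb1" for X
  proof -
    obtain g where g: "invertible g" "X = conj_act (diag_mat d) g"
      using X by (auto simp: Orb1 adj_orbit_def)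
    have "G (diag_mat d) = P (diag_mat d)"
      using G \<psi> by (simp add: matrix_function_def e(1) \<phi>)
    then show ?thesis
      using P L g G_conj unfolding equivariant_map_def by simp
  qed
  show ?thesis
    unfolding holo_def
  proof (intro CollectI ballI)
    fix X assume X: "X \<in> Orb1"
    then have "P X \<in> Orb2"
      using P by (auto simp: equivariant_map_def)
    then obtain U F where U: "open U" "P X \<in> U"
      and F: "\<forall>Y\<in>U. \<exists>F'. (F has_derivative F') (at Y) \<and> (\<forall>c V. F' (mscale c V) = c * F' V)"
      and eq: "\<forall>Y\<in>U \<inter> Orb2. f Y = F Y"
      using f unfolding holo_def by blast
    have cont: "isCont G Y" for Y
      using G has_derivative_continuous unfolding matrix_function_def by blast
    show "\<exists>U F. open U \<and> X \<in> U \<and>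
        (\<forall>Y\<in>U. \<exists>F'. (F has_derivative F') (at Y) \<and> (\<forall>c V. F' (mscale c V) = c * F' V)) \<and>
        (\<forall>Y\<in>U \<inter> Orb1. (f \<circ> P) Y = F Y)"
    proof (rule exI[of _ "G -` U"], rule exI[of _ "F \<circ> G"], intro conjI ballI)
      show "open (G -` U)"
        using U(1) cont by (intro continuous_open_vimage) (auto simp: continuous_on_eq_continuous_at)
      show "X \<in> G -` U"
        using U(2) GP[OF X] by simp
      show "(f \<circ> P) Y = (F \<circ> G) Y" if "Y \<in> G -` U \<inter> Orb1" for Y
        using that GP[of Y] eq P by (auto simp: equivariant_map_def image_subset_iff)
      fix Y assume "Y \<in> G -` U"
      then obtain F' where F': "(F has_derivative F') (at (G Y))" "\<forall>c V. F' (mscale c V) = c * F' V"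
        using F by auto
      obtain G' where G': "(G has_derivative G') (at Y)" "\<forall>c V. G' (mscale c V) = mscale c (G' V)"
        using G unfolding matrix_function_def by blast
      show "\<exists>F'. (F \<circ> G has_derivative F') (at Y) \<and> (\<forall>c V. F' (mscale c V) = c * F' V)"
        by (rule exI[of _ "F' \<circ> G'"]) (use F' G' diff_chain_at in auto)
    qed
  qed
qed

section \<open>Brackets evaluated from an arbitrary diagonal point\<close>

lemma defined_by_eq:
  fixes f h :: "'n::{finite,linorder} cmat \<Rightarrow> complex"
  assumes \<pi>: "defined_by Orb r bs c \<pi>" and Orb: "Orb = adj_orbit (diag_mat d)"
    and g: "invertible g" and f: "f \<in> holo Orb" and h: "h \<in> holo Orb"
  shows "\<pi> f h (conj_act (diag_mat d) g) = action_field r f h (conj_act (diag_mat d) g) +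
    diag_pairing d c (\<lambda>a. fund_deriv (conj_act (munit a) g) f (conj_act (diag_mat d) g))
      (\<lambda>a. fund_deriv (conj_act (munit a) g) h (conj_act (diag_mat d) g))"
proof -
  have mem: "conj_act (diag_mat d) g \<in> Orb" "diag_mat d \<in> Orb"
    by (simp_all add: Orb adj_orbitI[OF g] self_mem_adj_orbit)
  have bs: "block_base Orb bs"
    using \<pi> by (simp add: defined_by_def)
  have "\<pi> f h (conj_act (diag_mat d) g) = rs_field r bs c f h (conj_act (diag_mat d) g)"
    using \<pi> f h mem by (simp add: defined_by_def bifield_eq_def)
  then show ?thesis
    unfolding rs_field_def invariant_field_eq[OF bs Orb mem(2) g refl f h] .
qed

text \<open>The constant \<open>c\<close> survives any reordering of the eigenvalues, as both
  presentations agree with the same formula at the diagonal point of \<open>bs'\<close>.\<close>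

lemma defined_by_reorder:
  fixes Orb :: "'n::{finite,linorder} cmat set"
  assumes \<pi>: "defined_by Orb r bs c \<pi>" and Orb: "Orb = adj_orbit Z"
    and bs': "block_base Orb bs'"
  shows "defined_by Orb r bs' c \<pi>"
proof -
  let ?d = "block_value bs'"
  have mem: "diag_mat ?d \<in> Orb"
    using bs' by (simp add: block_base_def block_diag_eq)
  then have Orb': "Orb = adj_orbit (diag_mat ?d)"
    using Orb adj_orbit_eq by metis
  have "\<pi> f h X = rs_field r bs' c f h X"
    if f: "f \<in> holo Orb" and h: "h \<in> holo Orb" and X: "X \<in> Orb" for f h X
  proof -
    obtain g where g: "invertible g" "X = conj_act (diag_mat ?d) g"
      using X by (auto simp: Orb' adj_orbit_def)
    show ?thesis
      unfolding rs_field_def invariant_field_eq[OF bs' Orb mem g f h]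
      using defined_by_eq[OF \<pi> Orb' g(1) f h] g(2) by simp
  qed
  then show ?thesis
    using bs' by (simp add: defined_by_def bifield_eq_def)
qed

section \<open>The Poisson condition on the coefficients\<close>

text \<open>With one \<open>g\<close> for both orbits the covectors on the two sides coincide and
  the action parts cancel, leaving two diagonal pairings to compare. Where \<open>e s = e t\<close>
  the covectors vanish, so only the remaining pairs impose a condition.\<close>

lemma poisson_map_iff:
  fixes Orb1 Orb2 :: "'n::{finite,linorder} cmat set"
  assumes P: "equivariant_map Orb1 Orb2 P"
    and Orb1: "Orb1 = adj_orbit (diag_mat d)" and Orb2: "Orb2 = adj_orbit (diag_mat e)"
    and Pd: "P (diag_mat d) = diag_mat e"
    and \<pi>1: "defined_by Orb1 r bs a \<pi>1" and \<pi>2: "defined_by Orb2 r ms b \<pi>2"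
  shows "poisson_map Orb1 \<pi>1 Orb2 \<pi>2 P \<longleftrightarrow>
    (\<forall>s t. e s \<noteq> e t \<longrightarrow> (d s + d t + a) / (d s - d t) = (e s + e t + b) / (e s - e t))"
    (is "_ \<longleftrightarrow> ?coef")
proof -
  have mem: "diag_mat d \<in> Orb1"
    by (simp add: Orb1 self_mem_adj_orbit)
  have PX: "P (conj_act (diag_mat d) g) = conj_act (diag_mat e) g" if "invertible g" for g
    using P mem Pd that by (simp add: equivariant_map_def)
  have bracket1: "\<pi>1 (f \<circ> P) (h \<circ> P) (conj_act (diag_mat d) g) =
      action_field r f h (conj_act (diag_mat e) g) +
      diag_pairing d a (\<lambda>x. fund_deriv (conj_act (munit x) g) f (conj_act (diag_mat e) g))
        (\<lambda>x. fund_deriv (conj_act (munit x) g) h (conj_act (diag_mat e) g))"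
    if g: "invertible g" and f: "f \<in> holo Orb2" and h: "h \<in> holo Orb2" for g f h
  proof -
    have X: "conj_act (diag_mat d) g \<in> Orb1"
      by (simp add: Orb1 adj_orbitI g)
    have fP: "f \<circ> P \<in> holo Orb1" and hP: "h \<circ> P \<in> holo Orb1"
      using equivariant_compose_holo[OF P Orb1] f h by blast+
    show ?thesis
      unfolding defined_by_eq[OF \<pi>1 Orb1 g fP hP] fund_deriv_equivariant[OF P X] action_field_def
        bivector_at_def PX[OF g] ..
  qed
  have coef: "\<pi>1 (f \<circ> P) (h \<circ> P) (conj_act (diag_mat d) g) = \<pi>2 f h (P (conj_act (diag_mat d) g)) \<longleftrightarrow>
      diag_pairing d a (\<lambda>x. fund_deriv (conj_act (munit x) g) f (conj_act (diag_mat e) g))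
        (\<lambda>x. fund_deriv (conj_act (munit x) g) h (conj_act (diag_mat e) g)) =
      diag_pairing e b (\<lambda>x. fund_deriv (conj_act (munit x) g) f (conj_act (diag_mat e) g))
        (\<lambda>x. fund_deriv (conj_act (munit x) g) h (conj_act (diag_mat e) g))"
    if g: "invertible g" and f: "f \<in> holo Orb2" and h: "h \<in> holo Orb2" for g f h
    unfolding bracket1[OF that] PX[OF g] defined_by_eq[OF \<pi>2 Orb2 g f h] by simp
  show ?thesis
  proof
    assume poisson: "poisson_map Orb1 \<pi>1 Orb2 \<pi>2 P"
    show ?coef
    proof (intro allI impI)
      fix s t assume ne: "e s \<noteq> e t"
      \<comment> \<open>At the base point the derivatives of these entries are supported on
        \<open>munit (s, t)\<close> and \<open>munit (t, s)\<close>, so each pairing reduces to one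
        coefficient times the same nonzero factor.\<close>
      let ?f = "\<lambda>Y :: 'n cmat. Y $ s $ t" and ?h = "\<lambda>Y :: 'n cmat. Y $ t $ s"
      have f: "?f \<in> holo Orb2" and h: "?h \<in> holo Orb2"
        by (rule entry_holo)+
      have D: "fund_deriv (munit x) (\<lambda>Y. Y $ i $ j) (diag_mat e) =
          (if x = (i, j) then e i - e j else 0)" for x i j
        by (auto simp: fund_deriv_entry[OF self_mem_adj_orbit] lie_diag_munit)
      have pairing: "diag_pairing d' c (\<lambda>x. fund_deriv (munit x) ?f (diag_mat e))
          (\<lambda>x. fund_deriv (munit x) ?h (diag_mat e)) =
          (d' s + d' t + c) / (d' s - d' t) * (e s - e t) * (e t - e s)" for d' c
      proof -
        have "(d' u + d' v + c) / (d' u - d' v) * (if (u, v) = (s, t) then e s - e t else 0) *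
            (if (v, u) = (t, s) then e t - e s else 0) =
          (if u = s \<and> v = t then (d' u + d' v + c) / (d' u - d' v) * (e s - e t) * (e t - e s) else 0)"
          for u v by simp
        then show ?thesis
          unfolding diag_pairing_def D by (simp only: sum_sum_delta)
      qed
      have "\<pi>1 (?f \<circ> P) (?h \<circ> P) (conj_act (diag_mat d) (mat 1)) =
          \<pi>2 ?f ?h (P (conj_act (diag_mat d) (mat 1)))"
        using poisson f h mem unfolding poisson_map_def conj_act_one by blast
      note this[unfolded coef[OF invertible_one f h], unfolded conj_act_one pairing]
      then show "(d s + d t + a) / (d s - d t) = (e s + e t + b) / (e s - e t)"
        using ne by (metis mult_right_cancel right_minus_eq)
    qed
  next
    assume eq: ?coef
    have "\<pi>1 (f \<circ> P) (h \<circ> P) X = \<pi>2 f h (P X)"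
      if f: "f \<in> holo Orb2" and h: "h \<in> holo Orb2" and X: "X \<in> Orb1" for f h X
    proof -
      obtain g where g: "invertible g" "X = conj_act (diag_mat d) g"
        using X by (auto simp: Orb1 adj_orbit_def)
      let ?Y = "conj_act (diag_mat e) g"
      obtain F where F: "C_linear F" "\<And>A. fund_deriv A f ?Y = F (lie ?Y A)"
        using fund_deriv_holo[OF Orb2 _ f, of ?Y] adj_orbitI[OF g(1)] Orb2 by metis
      \<comment> \<open>Such a matrix unit, conjugated by \<open>g\<close>, commutes with
        \<open>?Y\<close>, so its coefficient is immaterial.\<close>
      have zero: "fund_deriv (conj_act (munit (s, t)) g) f ?Y = 0" if "e s = e t" for s t
      proof -
        have "fund_deriv (conj_act (munit (s, t)) g) f ?Y = F (mscale 0 (conj_act (munit (s, t)) g))"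
          by (simp only: F(2) conj_act_lie[OF g(1), symmetric] lie_diag_munit fst_conv snd_conv that
              diff_self conj_act_mscale)
        also have "\<dots> = 0"
          using C_linear_mscale[OF F(1), of 0] by simp
        finally show ?thesis .
      qed
      have term_eq: "(d s + d t + a) / (d s - d t) * fund_deriv (conj_act (munit (s, t)) g) f ?Y * y =
          (e s + e t + b) / (e s - e t) * fund_deriv (conj_act (munit (s, t)) g) f ?Y * y" for s t y
      proof (cases "e s = e t")
        case True
        then show ?thesis
          by (simp only: zero mult_zero_left mult_zero_right)
      next
        case False
        then show ?thesis
          using eq by metis
      qed
      show ?thesis
        unfolding g(2) coef[OF g(1) f h] diag_pairing_def
        by (intro sum.cong refl term_eq)
    qed
    then show "poisson_map Orb1 \<pi>1 Orb2 \<pi>2 P"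
      using P equivariant_compose_holo[OF P Orb1]
      by (auto simp: poisson_map_def equivariant_map_def)
  qed
qed

section \<open>Eigenvalues and permutations of the blocks\<close>

lemma eigenvalues_conj_act:
  fixes X :: "'n::finite cmat"
  assumes g: "invertible g"
  shows "eigenvalues (conj_act X g) = eigenvalues X"
proof -
  have sub: "eigenvalues (conj_act Y k) \<subseteq> eigenvalues Y" if k: "invertible k" for Y k :: "'n cmat"
  proof
    fix c assume "c \<in> eigenvalues (conj_act Y k)"
    then obtain v where v: "v \<noteq> 0" "conj_act Y k *v v = c *s v"
      by (auto simp: eigenvalues_def)
    have "Y *v (k *v v) = k *v (conj_act Y k *v v)"
      by (simp only: matrix_vector_mul_assoc mult_conj_act[OF k])
    also have "\<dots> = c *s (k *v v)"
      by (simp add: v(2) vector_scalar_commute)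
    finally have "Y *v (k *v v) = c *s (k *v v)" .
    moreover have "k *v v \<noteq> 0"
      using inj_matrix_vector_mult[OF k] v(1) by (metis injD matrix_vector_mult_0_right)
    ultimately show "c \<in> eigenvalues Y"
      by (auto simp: eigenvalues_def)
  qed
  show ?thesis
    using sub[OF g, of X] sub[OF invertible_matrix_inv[OF g], of "conj_act X g"]
    unfolding conj_act_inverse[OF g] by (rule equalityI)
qed

lemma eigenvalues_diag_mat: "eigenvalues (diag_mat d) = range d"
proof -
  have mult: "(diag_mat d *v v) $ i = d i * v $ i" for v i
    by (simp add: matrix_vector_mult_def if_distrib if_distribR cong: if_cong)
  show ?thesis
  proof (intro equalityI subsetI)
    fix c assume "c \<in> eigenvalues (diag_mat d)"
    then obtain v i where v: "diag_mat d *v v = c *s v" "v $ i \<noteq> 0"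
      by (auto simp: eigenvalues_def vec_eq_iff)
    have "d i * v $ i = c * v $ i"
      using mult[of v i] unfolding v(1) vector_smult_component by (rule sym)
    then show "c \<in> range d"
      using v(2) by (metis mult_right_cancel rangeI)
  next
    fix c assume "c \<in> range d"
    then obtain i where i: "c = d i"
      by blast
    have "diag_mat d *v axis i 1 = c *s axis i 1"
      unfolding vec_eq_iff mult by (simp add: axis_def i)
    then show "c \<in> eigenvalues (diag_mat d)"
      unfolding eigenvalues_def by (intro CollectI exI[of _ "axis i 1"]) (simp add: axis_eq_0_iff)
  qed
qed

text \<open>A single permutation matrix serves for all \<open>d\<close>, so the base points of
  source and target can be reordered together.\<close>

lemma diag_mat_permute:
  fixes p :: "'n::finite \<Rightarrow> 'n"
  assumes "bij p"
  obtains g where "invertible g" "\<And>d. conj_act (diag_mat d) g = diag_mat (d \<circ> p)"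
proof
  define g :: "'n cmat" where "g = (\<chi> i j. if i = p j then 1 else 0)"
  define h :: "'n cmat" where "h = (\<chi> i j. if j = p i then 1 else 0)"
  have "(h ** g) $ i $ j = mat 1 $ i $ j" for i j
  proof -
    have "(h ** g) $ i $ j = (\<Sum>k\<in>UNIV. if k = p i then (if k = p j then 1 else 0) else 0)"
      unfolding matrix_matrix_mult_nth by (intro sum.cong) (auto simp: g_def h_def)
    also have "\<dots> = (if p i = p j then 1 else 0)"
      by simp
    finally show ?thesis
      using bij_is_inj[OF assms] by (simp add: mat_def inj_eq)
  qed
  then have "h ** g = mat 1"
    by (simp add: vec_eq_iff)
  then show g: "invertible g"
    using invertible_left_inverse by blast
  show "conj_act (diag_mat d) g = diag_mat (d \<circ> p)" for d
    by (rule conj_act_eqI[OF g]) (simp add: vec_eq_iff g_def)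
qed

lemma block_value_eq_iff:
  assumes "valid_blocks TYPE('n) bs" "p < length bs"
  shows "block_value bs (i :: 'n::{finite,linorder}) = fst (bs ! p) \<longleftrightarrow> i \<in> block_indices bs p"
proof
  assume eq: "block_value bs i = fst (bs ! p)"
  obtain q where q: "q < length bs" "i \<in> block_indices bs q"
    using ex1_block_indices[OF assms(1)] by blast
  have "map fst bs ! q = map fst bs ! p"
    using eq block_value_block_indices[OF q] assms(2) q(1) by simp
  then have "q = p"
    using assms q(1) nth_eq_iff_index_eq[of "map fst bs" q p] by (simp add: valid_blocks_def)
  then show "i \<in> block_indices bs p"
    using q by simp
qed (rule block_value_block_indices[OF assms(2)])

text \<open>The first eigenvalue occupies an initial segment of ranks. Two lists with equal first
  multiplicity thus have the same first set of indices.\<close>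

lemma block_value_eq_first_iff:
  assumes "valid_blocks TYPE('n) bs"
  shows "block_value bs (i :: 'n::{finite,linorder}) = fst (bs ! 0) \<longleftrightarrow> rank_of i < snd (bs ! 0)"
proof -
  have "bs \<noteq> []"
    using assms by (auto simp: valid_blocks_def)
  then show ?thesis
    using block_value_eq_iff[OF assms, of 0] by (cases bs) (auto simp: block_indices_def)
qed

text \<open>The multiset of diagonal entries ignores the order of the blocks, and so detects when
  two block matrices differ by a permutation of indices.\<close>

lemma mset_block_value:
  assumes "valid_blocks TYPE('n::{finite,linorder}) bs"
  shows "image_mset (block_value bs) (mset_set (UNIV :: 'n set)) =
    mset (concat (map (\<lambda>(c, m). replicate m c) bs))"
proof -
  let ?xs = "concat (map (\<lambda>(c, m). replicate m c) bs)"
  have len: "length ?xs = CARD('n)"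
    using assms by (simp add: valid_blocks_def length_concat o_def case_prod_beta)
  have "image_mset (block_value bs) (mset_set (UNIV :: 'n set)) =
      image_mset (\<lambda>r. ?xs ! r) (image_mset rank_of (mset_set (UNIV :: 'n set)))"
    by (simp add: multiset.map_comp o_def block_value_def[abs_def])
  also have "image_mset rank_of (mset_set (UNIV :: 'n set)) = mset_set {0..<length ?xs}"
    using bij_rank_of[where 'n = 'n] by (simp add: bij_betw_def image_mset_mset_set len lessThan_atLeast0)
  also have "image_mset (\<lambda>r. ?xs ! r) (mset_set {0..<length ?xs}) = mset (map (\<lambda>r. ?xs ! r) [0..<length ?xs])"
    by simp
  also have "\<dots> = mset ?xs"
    by (simp only: map_nth)
  finally show ?thesis .
qed

text \<open>Moving the block of \<open>k\<close> to the front keeps the multiset of diagonal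
  entries, and equal multisets of values give a permutation of indices.\<close>

lemma valid_blocks_first:
  assumes bs: "valid_blocks TYPE('n::{finite,linorder}) bs"
  obtains bs' p where "valid_blocks TYPE('n) bs'" "fst (bs' ! 0) = block_value bs (k :: 'n)"
    "bij p" "block_value bs' = block_value bs \<circ> (p :: 'n \<Rightarrow> 'n)"
proof -
  obtain q where q: "q < length bs" "block_value bs k = fst (bs ! q)"
    using ex1_block_indices[OF bs, of k] block_value_block_indices by blast
  define bs' where "bs' = bs ! q # remove1 (bs ! q) bs"
  have mset: "mset bs' = mset bs"
    using q(1) by (simp add: bs'_def)
  have sums: "sum_list (map f bs') = sum_list (map f bs)" for f :: "complex \<times> nat \<Rightarrow> 'b::comm_monoid_add"
    using mset by (metis mset_map sum_mset_sum_list)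
  have "distinct (map fst bs') = distinct (map fst bs)"
    using mset by (intro mset_eq_imp_distinct_iff) simp
  then have valid: "valid_blocks TYPE('n) bs'"
    using bs mset_eq_setD[OF mset] sums[of snd] by (simp add: valid_blocks_def)
  have "mset (concat (map (\<lambda>(c, m). replicate m c) bs')) = mset (concat (map (\<lambda>(c, m). replicate m c) bs))"
    using sums[of "\<lambda>(c, m). mset (replicate m c)"]
    by (simp add: mset_concat o_def split_beta')
  then have "image_mset (block_value bs') (mset_set (UNIV :: 'n set)) =
      image_mset (block_value bs) (mset_set (UNIV :: 'n set))"
    by (simp only: mset_block_value[OF bs] mset_block_value[OF valid])
  then obtain p where p: "p permutes UNIV" "\<forall>x\<in>UNIV. block_value bs' (x :: 'n) = block_value bs (p x)"
    using image_mset_eq_implies_permutes[OF finite] by metis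
  show thesis
  proof (rule that[OF valid])
    show "fst (bs' ! 0) = block_value bs k"
      by (simp add: bs'_def q(2))
    show "bij p"
      using p(1) by (rule permutes_bij)
    show "block_value bs' = block_value bs \<circ> p"
      using p(2) by auto
  qed
qed

section \<open>Equivariant Poisson maps\<close>

text \<open>If the translates of \<open>diag_mat d\<close> by \<open>g\<close> and \<open>h\<close>
  differ but have the same image, then \<open>g ** matrix_inv h\<close> commutes with
  \<open>diag_mat e\<close> and not with \<open>diag_mat d\<close>. An entry violating the second
  commutation is nonzero and has \<open>d i \<noteq> d j\<close>; the first then forces
  \<open>e i = e j\<close>.\<close>

lemma equivariant_not_inj:
  assumes P: "equivariant_map Orb1 Orb2 P" and Orb1: "Orb1 = adj_orbit (diag_mat d)"
    and Pd: "P (diag_mat d) = diag_mat e" and not_inj: "\<not> inj_on P Orb1"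
  obtains i j where "d i \<noteq> d j" "e i = e j"
proof -
  obtain X Y where XY: "X \<in> Orb1" "Y \<in> Orb1" "P X = P Y" "X \<noteq> Y"
    using not_inj by (auto simp: inj_on_def)
  obtain g h where g: "invertible g" "X = conj_act (diag_mat d) g"
    and h: "invertible h" "Y = conj_act (diag_mat d) h"
    using XY(1,2) by (auto simp: Orb1 adj_orbit_def)
  define k where "k = g ** matrix_inv h"
  have k: "invertible k"
    unfolding k_def by (intro invertible_mult invertible_matrix_inv g h)
  have kh: "k ** h = g"
    by (simp add: k_def matrix_mul_assoc[symmetric] matrix_inv_inverse[OF h(1)])
  have "P X = conj_act (diag_mat e) g" "P Y = conj_act (diag_mat e) h"
    using P Pd g h self_mem_adj_orbit[of "diag_mat d"] by (simp_all add: Orb1 equivariant_map_def)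
  then have "conj_act (diag_mat e) g = conj_act (diag_mat e) h"
    using XY(3) by simp
  then have "conj_act (diag_mat e) k = conj_act (conj_act (diag_mat e) h) (matrix_inv h)"
    by (simp add: k_def conj_act_conj_act[OF g(1) invertible_matrix_inv[OF h(1)], symmetric])
  then have "conj_act (diag_mat e) k = diag_mat e"
    by (simp add: conj_act_inverse[OF h(1)])
  then have "k ** diag_mat e = diag_mat e ** k"
    using mult_conj_act[OF k, of "diag_mat e"] by simp
  then have ke: "k $ i $ j * e j = e i * k $ i $ j" for i j
    by (metis diag_mat_mult_nth)
  have "diag_mat d ** k \<noteq> k ** diag_mat d"
  proof
    assume "diag_mat d ** k = k ** diag_mat d"
    then have "conj_act (diag_mat d) k = diag_mat d"
      by (rule conj_act_eqI[OF k])
    then have "X = Y"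
      using conj_act_conj_act[OF k h(1), of "diag_mat d"] g(2) h(2) kh by simp
    then show False
      using XY(4) by simp
  qed
  then obtain i j where ij: "d i * k $ i $ j \<noteq> k $ i $ j * d j"
    by (auto simp: vec_eq_iff)
  then have "d i \<noteq> d j" and nz: "k $ i $ j \<noteq> 0"
    by auto
  moreover have "e i = e j"
    using ke[of i j] nz by simp
  ultimately show thesis
    using that by blast
qed

text \<open>Scalar matrices are central. Contrapositively, if the orbit of \<open>diag_mat e\<close>
  has more than one point, then \<open>e\<close> takes two distinct values.\<close>

lemma adj_orbit_scalar:
  assumes "\<And>i. e i = c"
  shows "adj_orbit (diag_mat e) = {diag_mat e}"
proof -
  have "diag_mat e = mscale c (mat 1)"
    by (simp add: vec_eq_iff assms mat_def)
  then have "conj_act (diag_mat e) g = diag_mat e" if "invertible g" for g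
    using that by (simp add: conj_act_mscale conj_act_mat_one)
  then show ?thesis
    using self_mem_adj_orbit[of "diag_mat e"] by (auto simp: adj_orbit_def)
qed

text \<open>As a function of \<open>x\<close> the fraction is 1 plus
  \<open>(a + 2 * z) / (x - z)\<close>, which is injective unless \<open>a + 2 * z\<close> is
  zero.\<close>

lemma constant_from_equal_coefficients:
  fixes x y z a :: complex
  assumes "x \<noteq> y" "x \<noteq> z" "y \<noteq> z" "(x + z + a) / (x - z) = (y + z + a) / (y - z)"
  shows "a = - 2 * z"
proof -
  have "(x + z + a) * (y - z) = (y + z + a) * (x - z)"
    using assms by (simp add: frac_eq_eq)
  then have "(x - y) * (a + 2 * z) = 0"
    by (simp add: algebra_simps)
  then show ?thesis
    using assms(1) by (simp add: add_eq_0_iff)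
qed

text \<open>Equal multiplicities make the first blocks of both matrices the same set of indices. As
  the target has two blocks, every relevant pair (s, t) meets this set in exactly one index; the
  chosen constants make both coefficients -1 if that index is \<open>s\<close>, and both 1 if it is
  \<open>t\<close>.\<close>

lemma poisson_mapI:
  fixes Orb1 Orb2 :: "'n::{finite,linorder} cmat set"
  assumes P: "equivariant_map Orb1 Orb2 P"
    and Orb1: "Orb1 = adj_orbit Z1" and Orb2: "Orb2 = adj_orbit Z2"
    and len: "length ms = 2"
    and PL: "P (block_diag bs) = block_diag ms"
    and mult: "snd (bs ! 0) = snd (ms ! 0)"
    and \<pi>1: "defined_by Orb1 r bs (- 2 * fst (bs ! 0)) \<pi>1"
    and \<pi>2: "defined_by Orb2 r ms (- 2 * fst (ms ! 0)) \<pi>2"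
  shows "poisson_map Orb1 \<pi>1 Orb2 \<pi>2 P"
proof -
  let ?d = "block_value bs :: 'n \<Rightarrow> complex" and ?e = "block_value ms :: 'n \<Rightarrow> complex"
  let ?x = "fst (bs ! 0)" and ?y = "fst (ms ! 0)" and ?z = "fst (ms ! 1)"
  have bs: "valid_blocks TYPE('n) bs" "diag_mat ?d \<in> Orb1"
    and ms: "valid_blocks TYPE('n) ms" "diag_mat ?e \<in> Orb2"
    using \<pi>1 \<pi>2 by (simp_all add: defined_by_def block_base_def block_diag_eq)
  have Orb1': "Orb1 = adj_orbit (diag_mat ?d)" and Orb2': "Orb2 = adj_orbit (diag_mat ?e)"
    using bs(2) ms(2) Orb1 Orb2 adj_orbit_eq by metis+
  have first: "?d i = ?x \<longleftrightarrow> ?e i = ?y" for i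
    by (simp only: block_value_eq_first_iff[OF bs(1)] block_value_eq_first_iff[OF ms(1)] mult)
  have two: "?e i = ?y \<or> ?e i = ?z" for i
  proof -
    obtain p where "p < length ms" "i \<in> block_indices ms p"
      using ex1_block_indices[OF ms(1), of i] by blast
    moreover from this len have "p = 0 \<or> p = 1"
      by auto
    ultimately show ?thesis
      using block_value_block_indices[of p ms i] by blast
  qed
  have "(?d s + ?d t + - 2 * ?x) / (?d s - ?d t) = (?e s + ?e t + - 2 * ?y) / (?e s - ?e t)"
    if ne: "?e s \<noteq> ?e t" for s t
  proof (cases "?e s = ?y")
    case True
    then have "?d s = ?x" "?d t \<noteq> ?x" "?e t \<noteq> ?y"
      using ne first by auto
    then show ?thesis
      using True by (simp add: divide_simps) (simp add: algebra_simps)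
  next
    case False
    then have "?e t = ?y"
      using ne two by metis
    then have "?d t = ?x" "?d s \<noteq> ?x"
      using False first by auto
    then show ?thesis
      using False \<open>?e t = ?y\<close> by (simp add: divide_simps)
  qed
  then show ?thesis
    using poisson_map_iff[OF P Orb1' Orb2' PL[unfolded block_diag_eq] \<pi>1 \<pi>2] by blast
qed

lemma poisson_mapD:
  fixes Orb1 Orb2 :: "'n::{finite,linorder} cmat set"
  assumes P: "equivariant_map Orb1 Orb2 P"
    and Orb1: "Orb1 = adj_orbit Z1" and Orb2: "Orb2 = adj_orbit Z2"
    and \<pi>1: "defined_by Orb1 r bs a \<pi>1" and \<pi>2: "defined_by Orb2 r ms b \<pi>2"
    and not_inj: "\<not> inj_on P Orb1" and not_sing: "\<not> is_singleton Orb2"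
    and poisson: "poisson_map Orb1 \<pi>1 Orb2 \<pi>2 P"
  shows "(\<forall>X\<in>Orb2. card (eigenvalues X) = 2) \<and>
    (\<exists>bs ms. block_base Orb1 bs \<and> block_base Orb2 ms \<and> length ms = 2 \<and>
       P (block_diag bs) = block_diag ms \<and> snd (bs ! 0) = snd (ms ! 0) \<and>
       defined_by Orb1 r bs (- 2 * fst (bs ! 0)) \<pi>1 \<and>
       defined_by Orb2 r ms (- 2 * fst (ms ! 0)) \<pi>2)"
proof -
  let ?d = "block_value bs :: 'n \<Rightarrow> complex"
  have bs: "valid_blocks TYPE('n) bs" "diag_mat ?d \<in> Orb1"
    using \<pi>1 by (simp_all add: defined_by_def block_base_def block_diag_eq)
  have Orb1': "Orb1 = adj_orbit (diag_mat ?d)"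
    using bs(2) Orb1 adj_orbit_eq by metis
  obtain e where e: "P (diag_mat ?d) = diag_mat e" "\<And>s t. ?d s = ?d t \<Longrightarrow> e s = e t"
    using equivariant_diag[OF P bs(2)] by blast
  have "diag_mat e \<in> Orb2"
    using P bs(2) e(1) by (metis equivariant_map_def image_subset_iff)
  then have Orb2': "Orb2 = adj_orbit (diag_mat e)"
    using Orb2 adj_orbit_eq by metis
  have coef: "(?d s + ?d t + a) / (?d s - ?d t) = (e s + e t + b) / (e s - e t)"
    if "e s \<noteq> e t" for s t
    using poisson that unfolding poisson_map_iff[OF P Orb1' Orb2' e(1) \<pi>1 \<pi>2] by blast
  obtain i j where ij: "?d i \<noteq> ?d j" "e i = e j"
    using equivariant_not_inj[OF P Orb1' e(1) not_inj] by blast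
  have a: "a = - 2 * ?d k" if "e k \<noteq> e i" for k
  proof (rule constant_from_equal_coefficients[OF ij(1)])
    show "?d i \<noteq> ?d k" "?d j \<noteq> ?d k"
      using that e(2) ij(2) by metis+
    show "(?d i + ?d k + a) / (?d i - ?d k) = (?d j + ?d k + a) / (?d j - ?d k)"
      using coef[of i k] coef[of j k] that ij(2) by metis
  qed
  \<comment> \<open>If \<open>e\<close> were constant, the target orbit would be a point.\<close>
  obtain k where k: "e k \<noteq> e i"
    using adj_orbit_scalar[of e "e i"] not_sing Orb2' by (metis is_singletonI)
  \<comment> \<open>Since \<open>a\<close> determines \<open>?d k\<close>, the indices outside the
    fibre of \<open>e i\<close> form a single block of the source.\<close>
  have same: "e l \<noteq> e i \<longleftrightarrow> ?d l = ?d k" for l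
  proof
    assume "e l \<noteq> e i"
    then show "?d l = ?d k"
      using a[of l] a[OF k] by simp
  next
    assume "?d l = ?d k"
    then have "e l = e k"
      by (rule e(2))
    then show "e l \<noteq> e i"
      using k by metis
  qed
  have ek: "e l = (if ?d l = ?d k then e k else e i)" for l
  proof (cases "?d l = ?d k")
    case True
    then show ?thesis
      using e(2)[OF True] by metis
  qed (use same in metis)
  have b: "b = - 2 * e k"
  proof -
    have "?d i \<noteq> ?d k"
      using same by metis
    \<comment> \<open>With \<open>a = - 2 * ?d k\<close> the numerator on the source side becomes
      \<open>?d i - ?d k\<close>.\<close>
    then have "(e i + e k + b) / (e i - e k) = 1"
      using coef[of i k] k a[OF k] by simp
    then have "e i + e k + b = e i - e k"
      using k by (simp add: divide_eq_eq_1 field_simps)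
    then show ?thesis
      by (simp add: algebra_simps eq_neg_iff_add_eq_0)
  qed
  \<comment> \<open>The order of blocks in \<open>bs\<close> was arbitrary; condition (b) wants the
    block of \<open>k\<close> first.\<close>
  obtain bs' and p :: "'n \<Rightarrow> 'n" where bs': "valid_blocks TYPE('n) bs'" "fst (bs' ! 0) = ?d k"
    and p: "bij p" "block_value bs' = ?d \<circ> p"
    using valid_blocks_first[OF bs(1), of k] by metis
  obtain g where g: "invertible g" "\<And>d. conj_act (diag_mat d) g = diag_mat (d \<circ> p)"
    using diag_mat_permute[OF p(1)] by metis
  have base1: "block_base Orb1 bs'"
    using adj_orbitI[OF g(1), of "diag_mat ?d"] bs'(1)
    by (simp add: block_base_def block_diag_eq p(2) Orb1' g(2))
  define m where "m = snd (bs' ! 0)"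
  have first: "?d (p l) = ?d k \<longleftrightarrow> rank_of l < m" for l
    using block_value_eq_first_iff[OF bs'(1), of l] p(2) bs'(2) by (simp add: m_def)
  obtain l where "p l = k"
    using p(1) by (metis bij_pointE)
  then have m_pos: "0 < m"
    using first[of l] by simp
  \<comment> \<open>An index sent to \<open>i\<close> lies outside the first block, which leaves a
    positive multiplicity for the second block of \<open>ms'\<close>.\<close>
  obtain l' where "p l' = i"
    using p(1) by (metis bij_pointE)
  then have "\<not> rank_of l' < m"
    using first[of l'] same by metis
  then have m_less: "m < CARD('n)"
    using rank_of_less[of l'] by simp
  \<comment> \<open>The multiplicity \<open>m\<close> is copied from the source; by
    \<open>ek\<close> it is also that of \<open>e k\<close> in the target.\<close>
  define ms' where "ms' = [(e k, m), (e i, CARD('n) - m)]"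
  have valid: "valid_blocks TYPE('n) ms'"
    using m_pos m_less k by (simp add: valid_blocks_def ms'_def)
  have "block_value ms' l = (e \<circ> p) l" for l :: 'n
  proof -
    have "block_value ms' l = (if rank_of l < m then e k else e i)"
      using rank_of_less[of l] by (simp add: block_value_def ms'_def nth_append)
    then show ?thesis
      unfolding o_apply ek[of "p l"] first .
  qed
  then have ms': "block_diag ms' = diag_mat (e \<circ> p)"
    unfolding block_diag_eq diag_mat_inject by (rule ext)
  have base2: "block_base Orb2 ms'"
    using adj_orbitI[OF g(1), of "diag_mat e"] valid
    by (simp add: block_base_def ms' Orb2' g(2))
  have "P (block_diag bs') = block_diag ms'"
  proof -
    have "P (conj_act (diag_mat ?d) g) = conj_act (P (diag_mat ?d)) g"
      using P g(1) bs(2) by (simp add: equivariant_map_def)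
    then show ?thesis
      unfolding block_diag_eq[of bs'] ms' p(2) e(1) g(2) .
  qed
  moreover have "defined_by Orb1 r bs' (- 2 * fst (bs' ! 0)) \<pi>1"
    using defined_by_reorder[OF \<pi>1 Orb1 base1] a[OF k] bs'(2) by simp
  moreover have "defined_by Orb2 r ms' (- 2 * fst (ms' ! 0)) \<pi>2"
    using defined_by_reorder[OF \<pi>2 Orb2 base2] b by (simp add: ms'_def)
  moreover have "card (eigenvalues X) = 2" if X: "X \<in> Orb2" for X
  proof -
    obtain h where h: "invertible h" "X = conj_act (diag_mat e) h"
      using X by (auto simp: Orb2' adj_orbit_def)
    have "range e = {e k, e i}"
    proof -
      have "e l \<in> {e k, e i}" for l
        using ek[of l] by (cases "?d l = ?d k") simp_all
      then show ?thesis
        by auto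
    qed
    then show ?thesis
      using k by (simp add: h eigenvalues_conj_act eigenvalues_diag_mat)
  qed
  ultimately show ?thesis
    using base1 base2 by (intro conjI ballI exI[of _ bs'] exI[of _ ms']) (simp_all add: ms'_def m_def)
qed

text \<open>Necessity is claimed when \<open>P\<close> identifies points and the target is not a
  single point. The identity of an orbit with a given bracket is Poisson for any number of
  eigenvalues, and so is every equivariant map to a point; outside this range the conditions can
  thus fail for a Poisson map.\<close>

theorem theorem1:
  fixes Orb1 Orb2 :: "'n::{finite,linorder} cmat set"
    and r :: "'n tens2"
    and \<pi>1 \<pi>2 :: "'n bifield"
    and P :: "'n cmat \<Rightarrow> 'n cmat"
  assumes "semisimple_orbit Orb1" and "semisimple_orbit Orb2"
    and "r_matrix r" and "normalized_on Orb1 r" and "normalized_on Orb2 r"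
    and "\<exists>bs a. defined_by Orb1 r bs a \<pi>1"
    and "\<exists>ms a. defined_by Orb2 r ms a \<pi>2"
    and "equivariant_map Orb1 Orb2 P"
  shows
    "let conditions_abc =
       symmetric_orbit Orb2 \<and>
       (\<exists>bs ms. block_base Orb1 bs \<and> block_base Orb2 ms \<and> length ms = 2 \<and>
          P (block_diag bs) = block_diag ms \<and>
          snd (bs ! 0) = snd (ms ! 0) \<and>
          defined_by Orb1 r bs (- 2 * fst (bs ! 0)) \<pi>1 \<and>
          defined_by Orb2 r ms (- 2 * fst (ms ! 0)) \<pi>2)
     in (conditions_abc \<longrightarrow> poisson_map Orb1 \<pi>1 Orb2 \<pi>2 P) \<and>
        (\<not> inj_on P Orb1 \<and> \<not> is_singleton Orb2 \<longrightarrow>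
           (poisson_map Orb1 \<pi>1 Orb2 \<pi>2 P \<longleftrightarrow> conditions_abc))"
proof -
  obtain Z1 Z2 where Orb: "Orb1 = adj_orbit Z1" "Orb2 = adj_orbit Z2"
    using assms(1,2) by (auto simp: semisimple_orbit_def)
  obtain bs a ms b where \<pi>: "defined_by Orb1 r bs a \<pi>1" "defined_by Orb2 r ms b \<pi>2"
    using assms(6,7) by blast
  note mapI = poisson_mapI[OF assms(8) Orb, of _ _ r \<pi>1 \<pi>2]
  note mapD = poisson_mapD[OF assms(8) Orb \<pi>]
  show ?thesis
    unfolding Let_def symmetric_orbit_def
    using mapI mapD assms(2) by (intro conjI impI iffI) blast+
qed

end
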